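(* Let $U=[\sigma_1,\sigma_2]$ be an interval in the weak Bruhat order on $\mathcal{S}_n$. If the width of $\sigma_1^{-1}\sigma_2$ is less than or equal to $k$, then $|U|$ can be computed in $O(k^2 n^{\max(3,k)})$ time.
   Context: $\mathcal{S}_n$ is the set of permutations (bijections) of $[n]=\{1,\dots,n\}$; composition is $(fg)(x)=f(g(x))$. The width of a permutation $\sigma$ is the length of a longest decreasing subsequence of the word $\sigma(1)\sigma(2)\cdots\sigma(n)$ (one-line notation). Weak Bruhat order $\prec$ on $\mathcal{S}_n$: the reflexive and transitive closure of the covering relation $\lessdot$, where $\sigma_1\lessdot\sigma_2$ if and only if there is an adjacent transposition $\tau$ exchanging $k$ and $l$ (so $|k-l|=1$) with $\sigma_1=\sigma_2\tau$, $k<l$ and $\sigma_1(k)<\sigma_1(l)$. The interval $[\sigma_1,\sigma_2]$ is $\{\rho\in\mathcal{S}_n : \sigma_1\prec\rho\prec\sigma_2\}$. Running times are in the usual sense of algorithm analysis (the algorithm takes the permutations $\sigma_1,\sigma_2$ as input and outputs the integer $|U|$); no particular machine model is specified. *)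

theory Defs
  imports Complex_Main "HOL-Combinatorics.Permutations" "HOL-Library.Sublist"
begin

section \<open>Weak Bruhat order and width\<close>

text \<open>
  The elements of \<open>S\<^sub>n\<close> are the functions \<open>\<sigma> :: nat \<Rightarrow> nat\<close> with \<open>\<sigma> permutes {1..n}\<close>; they are the
  identity outside \<open>{1..n}\<close>, so equality, composition and inverse of functions are those of \<open>S\<^sub>n\<close>.
\<close>

definition weak_cover :: "nat \<Rightarrow> (nat \<Rightarrow> nat) \<Rightarrow> (nat \<Rightarrow> nat) \<Rightarrow> bool" where
  "weak_cover n \<sigma>\<^sub>1 \<sigma>\<^sub>2 \<longleftrightarrow>
     \<sigma>\<^sub>1 permutes {1..n} \<and> \<sigma>\<^sub>2 permutes {1..n} \<and>
     (\<exists>k\<in>{1..n}. \<exists>l\<in>{1..n}. \<bar>int k - int l\<bar> = 1 \<and>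
        \<sigma>\<^sub>1 = \<sigma>\<^sub>2 \<circ> transpose k l \<and> k < l \<and> \<sigma>\<^sub>1 k < \<sigma>\<^sub>1 l)"

definition weak_le :: "nat \<Rightarrow> (nat \<Rightarrow> nat) \<Rightarrow> (nat \<Rightarrow> nat) \<Rightarrow> bool" where
  "weak_le n = (weak_cover n)\<^sup>*\<^sup>*"

definition weak_interval :: "nat \<Rightarrow> (nat \<Rightarrow> nat) \<Rightarrow> (nat \<Rightarrow> nat) \<Rightarrow> (nat \<Rightarrow> nat) set" where
  "weak_interval n \<sigma>\<^sub>1 \<sigma>\<^sub>2 = {\<rho>. \<rho> permutes {1..n} \<and> weak_le n \<sigma>\<^sub>1 \<rho> \<and> weak_le n \<rho> \<sigma>\<^sub>2}"

definition one_line :: "nat \<Rightarrow> (nat \<Rightarrow> nat) \<Rightarrow> nat list" where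
  "one_line n \<sigma> = map \<sigma> [1..<Suc n]"

definition width :: "nat \<Rightarrow> (nat \<Rightarrow> nat) \<Rightarrow> nat" where
  "width n \<sigma> = Max {length xs | xs. subseq xs (one_line n \<sigma>) \<and> sorted_wrt (>) xs}"


section \<open>A unit-cost random access machine\<close>

text \<open>
  Programs are while programs over finitely many scalar variables and a random access memory,
  both holding natural numbers. Every operation (constant, variable access, memory access,
  addition, subtraction, comparison, connective, assignment, test) costs one unit of time.
  As in the RAM of Cook and Reckhow, there is no multiplication (nor division or shift): with
  unit cost it would let a program build numbers of exponential length in linear time.
\<close>

type_synonym vname = string
type_synonym state = "(vname \<Rightarrow> nat) \<times> (nat \<Rightarrow> nat)"

datatype aexp =
    N nat
  | V vname
  | Plus aexp aexp
  | Minus aexp aexp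
  | Load aexp

text \<open>Subtraction is truncated: \<open>x - y = 0\<close> if \<open>x \<le> y\<close>.\<close>

fun aval :: "aexp \<Rightarrow> state \<Rightarrow> nat" where
  "aval (N c) s = c"
| "aval (V x) s = fst s x"
| "aval (Plus a b) s = aval a s + aval b s"
| "aval (Minus a b) s = aval a s - aval b s"
| "aval (Load a) s = snd s (aval a s)"

fun acost :: "aexp \<Rightarrow> nat" where
  "acost (N c) = 1"
| "acost (V x) = 1"
| "acost (Plus a b) = 1 + acost a + acost b"
| "acost (Minus a b) = 1 + acost a + acost b"
| "acost (Load a) = 1 + acost a"

datatype bexp =
    Less aexp aexp
  | Neg bexp
  | Conj bexp bexp

fun bval :: "bexp \<Rightarrow> state \<Rightarrow> bool" where
  "bval (Less a b) s \<longleftrightarrow> aval a s < aval b s"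
| "bval (Neg p) s \<longleftrightarrow> \<not> bval p s"
| "bval (Conj p q) s \<longleftrightarrow> bval p s \<and> bval q s"

fun bcost :: "bexp \<Rightarrow> nat" where
  "bcost (Less a b) = 1 + acost a + acost b"
| "bcost (Neg p) = 1 + bcost p"
| "bcost (Conj p q) = 1 + bcost p + bcost q"

datatype com =
    Skip
  | Assign vname aexp
  | Store aexp aexp
  | Seq com com
  | Cond bexp com com
  | While bexp com

text \<open>\<open>exec c s t s'\<close>: started in \<open>s\<close>, program \<open>c\<close> terminates in \<open>s'\<close> after \<open>t\<close> units of time.\<close>

inductive exec :: "com \<Rightarrow> state \<Rightarrow> nat \<Rightarrow> state \<Rightarrow> bool" where
  Skip: "exec Skip s 1 s"
| Assign: "exec (Assign x a) s (1 + acost a) ((fst s)(x := aval a s), snd s)"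
| Store: "exec (Store a b) s (1 + acost a + acost b) (fst s, (snd s)(aval a s := aval b s))"
| Seq: "exec c\<^sub>1 s t\<^sub>1 s' \<Longrightarrow> exec c\<^sub>2 s' t\<^sub>2 s'' \<Longrightarrow> exec (Seq c\<^sub>1 c\<^sub>2) s (t\<^sub>1 + t\<^sub>2) s''"
| CondTrue: "bval b s \<Longrightarrow> exec c\<^sub>1 s t s' \<Longrightarrow> exec (Cond b c\<^sub>1 c\<^sub>2) s (1 + bcost b + t) s'"
| CondFalse: "\<not> bval b s \<Longrightarrow> exec c\<^sub>2 s t s' \<Longrightarrow> exec (Cond b c\<^sub>1 c\<^sub>2) s (1 + bcost b + t) s'"
| WhileFalse: "\<not> bval b s \<Longrightarrow> exec (While b c) s (1 + bcost b) s"
| WhileTrue: "bval b s \<Longrightarrow> exec c s t\<^sub>1 s' \<Longrightarrow> exec (While b c) s' t\<^sub>2 s'' \<Longrightarrow>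
    exec (While b c) s (1 + bcost b + t\<^sub>1 + t\<^sub>2) s''"

text \<open>The final state and the running time are determined by the program and the initial state.\<close>

lemma exec_deterministic:
  "exec c s t s' \<Longrightarrow> exec c s u s'' \<Longrightarrow> t = u \<and> s' = s''"
proof (induction arbitrary: u s'' rule: exec.induct)
  case (Skip s)
  then show ?case by cases auto
next
  case (Assign x a s)
  then show ?case by cases auto
next
  case (Store a b s)
  then show ?case by cases auto
next
  case (Seq c\<^sub>1 s t\<^sub>1 s' c\<^sub>2 t\<^sub>2 r)
  from Seq.prems show ?case
    by cases (metis Seq.IH)
next
  case (CondTrue b s c\<^sub>1 t s' c\<^sub>2)
  from CondTrue.prems show ?case
    by cases (use CondTrue.hyps in \<open>auto dest!: CondTrue.IH\<close>)
next
  case (CondFalse b s c\<^sub>2 t s' c\<^sub>1)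
  from CondFalse.prems show ?case
    by cases (use CondFalse.hyps in \<open>auto dest!: CondFalse.IH\<close>)
next
  case (WhileFalse b s c)
  from WhileFalse.prems show ?case
    by cases (use WhileFalse.hyps in auto)
next
  case (WhileTrue b s c t\<^sub>1 s' t\<^sub>2 r)
  from WhileTrue.prems show ?case
    by cases (use WhileTrue.hyps in simp, metis WhileTrue.IH)
qed

text \<open>
  Input: \<open>n\<close> in cell 0, then \<open>\<sigma>\<^sub>1\<close> and \<open>\<sigma>\<^sub>2\<close> in one-line notation in cells \<open>1..n\<close> and
  \<open>n+1..2n\<close>. All other cells and all variables are 0. The output is read from cell 0.
\<close>

definition input_state :: "nat \<Rightarrow> (nat \<Rightarrow> nat) \<Rightarrow> (nat \<Rightarrow> nat) \<Rightarrow> state" where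
  "input_state n \<sigma>\<^sub>1 \<sigma>\<^sub>2 =
     ((\<lambda>_. 0),
      (\<lambda>a. if a = 0 then n else if a \<le> n then \<sigma>\<^sub>1 a else if a \<le> 2 * n then \<sigma>\<^sub>2 (a - n) else 0))"

definition computes_within :: "com \<Rightarrow> state \<Rightarrow> nat \<Rightarrow> nat \<Rightarrow> bool" where
  "computes_within c s r T \<longleftrightarrow> (\<exists>t s'. exec c s t s' \<and> snd s' 0 = r \<and> t \<le> T)"

end

theory Submission imports Defs begin

text \<open>
  A permutation lies in the interval iff it keeps the order of every pair of values on which \<open>\<sigma>\<^sub>1\<close> and
  \<open>\<sigma>\<^sub>2\<close> agree (provided \<open>\<sigma>\<^sub>1 \<prec> \<sigma>\<^sub>2\<close>, which is a test of inversions). So \<open>|U|\<close> is the number of linear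
  extensions of a two-dimensional order, whose antichains are the decreasing subsequences of
  \<open>\<sigma>\<^sub>1\<^sup>-\<^sup>1\<sigma>\<^sub>2\<close>. Splitting the elements by the length of a longest antichain ending in them gives
  \<open>m \<le> k\<close> chains with sizes \<open>s\<^sub>p\<close>, found in time \<open>O(n\<^sup>2)\<close>. Dynamic programming over tuples of
  prefixes of the chains counts the extensions by their last element: there are
  \<open>\<Prod>(s\<^sub>p + 1) \<le> 2 n\<^sup>m\<close> tuples, and finding the removable last elements of one costs \<open>O(m\<^sup>2)\<close> comparisons.
\<close>

section \<open>Intervals and linear extensions\<close>

text \<open>The machine cannot multiply, and this shapes the algorithm. A tuple of prefix lengths is
  addressed by its value as a mixed radix number. Shortening prefix \<open>p\<close> by one lowers
  this value by the fixed place value of digit \<open>p\<close>, so each smaller count is found by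
  one subtraction, and running through the tuples in counter order ensures that it is already
  stored. Place values and row offsets are prepared by repeated addition. The main term of the time
  is the number of tuples times the pairwise comparisons of chain tops; the exponent 3 more than
  covers the quadratic preprocessing when \<open>k\<close> is small. Operations have unit cost, so
  the size of the counts, which can reach n!, does not enter.\<close>

lemma transpose_Suc_less_iff:
  fixes x y k :: nat
  assumes "x \<noteq> y" "{x, y} \<noteq> {k, Suc k}"
  shows "transpose k (Suc k) x < transpose k (Suc k) y \<longleftrightarrow> x < y"
  using assms by (auto simp: transpose_def doubleton_eq_iff)

text \<open>Inversions are recorded as pairs of values. A cover changes the relative position of one
  pair of values only, and turns it from an ascent into an inversion, so inversions are never lost
  on the way up.\<close>

lemma weak_le_imp_inversions:
  assumes "weak_le n \<sigma> \<rho>" "a < b" "inv \<sigma> b < inv \<sigma> a"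
  shows "inv \<rho> b < inv \<rho> a"
  using assms(1) unfolding weak_le_def
proof (induction rule: rtranclp_induct)
  case base
  then show ?case using assms by simp
next
  case (step \<tau> \<rho>)
  from step.hyps(2) obtain k where k:
    "\<tau> permutes {1..n}" "\<rho> permutes {1..n}" "\<tau> = \<rho> \<circ> transpose k (Suc k)" "\<tau> k < \<tau> (Suc k)"
    unfolding weak_cover_def by (auto simp: abs_if split: if_splits) (smt (verit) Suc_eq_plus1 of_nat_Suc of_nat_eq_iff)
  have inv: "inv \<tau> = transpose k (Suc k) \<circ> inv \<rho>"
    using k(2,3) by (metis o_inv_distrib bij_transpose inv_transpose_eq permutes_bij)
  show ?case
  proof (cases "{inv \<rho> b, inv \<rho> a} = {k, Suc k}")
    case False
    have "inv \<rho> b \<noteq> inv \<rho> a"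
      using \<open>a < b\<close> k(2) by (metis less_irrefl permutes_inverses(1))
    with False show ?thesis
      using step.IH inv by (simp add: transpose_Suc_less_iff)
  next
    case True
    then consider "inv \<rho> b = k" "inv \<rho> a = Suc k" | "inv \<rho> b = Suc k" "inv \<rho> a = k"
      by (auto simp: doubleton_eq_iff)
    then show ?thesis
    proof cases
      \<comment> \<open>Here the cover's ascent \<open>\<tau> k < \<tau> (Suc k)\<close> reads
        \<open>b < a\<close>, a contradiction.\<close>
      case 2
      then have "b = \<rho> (Suc k)" "a = \<rho> k"
        using k(2) by (metis permutes_inverses(1))+
      then show ?thesis using k(3,4) \<open>a < b\<close> by simp
    qed simp
  qed
qed

text \<open>Used contrapositively: a permutation other than the identity has an adjacent descent,
  which is the place to swap.\<close>

lemma permutes_id_of_Suc_mono: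
  assumes "f permutes {1..n}" "\<And>k. 1 \<le> k \<Longrightarrow> k < n \<Longrightarrow> f k < f (Suc k)"
  shows "f = id"
proof (rule permutes_natset_ge[OF assms(1)], rule ballI)
  fix i assume "i \<in> {1..n}"
  then show "i \<le> f i"
  proof (induction i)
    case (Suc i)
    show ?case
    proof (cases "i = 0")
      case True
      have "f 1 \<in> {1..n}" using assms(1) Suc.prems True by (metis One_nat_def permutes_in_image)
      then show ?thesis using True by simp
    next
      case False
      then show ?thesis using Suc assms(2)[of i] by fastforce
    qed
  qed simp
qed

text \<open>Induction on the number of inversions of \<open>\<rho>\<close> missing in
  \<open>\<sigma>\<close>. If the two differ, \<open>inv \<rho> \<circ> \<sigma>\<close> has a
  descent at some \<open>k\<close>, and swapping positions \<open>k\<close> and \<open>Suc k\<close>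
  of \<open>\<sigma>\<close> is a cover that adds exactly one inversion, one of those
  missing.\<close>

lemma inversions_imp_weak_le:
  assumes "\<sigma> permutes {1..n}" "\<rho> permutes {1..n}"
    and "\<And>a b. a < b \<Longrightarrow> inv \<sigma> b < inv \<sigma> a \<Longrightarrow> inv \<rho> b < inv \<rho> a"
  shows "weak_le n \<sigma> \<rho>"
  using assms(1,3)
proof (induction "card {(a, b) \<in> {1..n} \<times> {1..n}. a < b \<and> inv \<rho> b < inv \<rho> a \<and> \<not> inv \<sigma> b < inv \<sigma> a}"
    arbitrary: \<sigma> rule: less_induct)
  case (less \<sigma>)
  note \<sigma> = less.prems(1) and \<rho> = assms(2)
  show ?case
  proof (cases "\<sigma> = \<rho>")
    case True
    then show ?thesis by (simp add: weak_le_def)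
  next
    case False
    have "inv \<rho> \<circ> \<sigma> \<noteq> id"
    proof
      assume "inv \<rho> \<circ> \<sigma> = id"
      then have "\<rho> \<circ> (inv \<rho> \<circ> \<sigma>) = \<rho>" by simp
      then have "\<sigma> = \<rho>" using permutes_inv_o(1)[OF \<rho>] by (simp add: o_assoc)
      with False show False by simp
    qed
    moreover have "inv \<rho> \<circ> \<sigma> permutes {1..n}"
      using \<sigma> \<rho> by (simp add: permutes_compose permutes_inv)
    ultimately obtain k where k: "1 \<le> k" "k < n" "\<not> inv \<rho> (\<sigma> k) < inv \<rho> (\<sigma> (Suc k))"
      using permutes_id_of_Suc_mono by fastforce
    have ne: "\<sigma> k \<noteq> \<sigma> (Suc k)"
      using permutes_inj[OF \<sigma>] by (simp add: inj_eq)
    then have "inv \<rho> (\<sigma> k) \<noteq> inv \<rho> (\<sigma> (Suc k))"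
      using permutes_inj[OF permutes_inv[OF \<rho>]] by (simp add: inj_eq)
    with k have invd: "inv \<rho> (\<sigma> (Suc k)) < inv \<rho> (\<sigma> k)" by simp
    \<comment> \<open>Otherwise this pair would be an inversion of \<open>\<sigma>\<close>, hence of
      \<open>\<rho>\<close>, against \<open>invd\<close>.\<close>
    have asc: "\<sigma> k < \<sigma> (Suc k)"
      using less.prems(2)[of "\<sigma> (Suc k)" "\<sigma> k"] ne k(3) permutes_inverses(2)[OF \<sigma>]
      by (metis invd lessI nat_neq_iff)
    define \<sigma>' where "\<sigma>' = \<sigma> \<circ> transpose k (Suc k)"
    have \<sigma>': "\<sigma>' permutes {1..n}"
      unfolding \<sigma>'_def using k by (intro permutes_compose[OF _ \<sigma>] permutes_swap_id) auto
    have inv: "inv \<sigma>' = transpose k (Suc k) \<circ> inv \<sigma>"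
      unfolding \<sigma>'_def using \<sigma> by (metis o_inv_distrib bij_transpose inv_transpose_eq permutes_bij)
    have iff: "inv \<sigma>' b < inv \<sigma>' a \<longleftrightarrow> inv \<sigma> b < inv \<sigma> a \<or> a = \<sigma> k \<and> b = \<sigma> (Suc k)" if "a < b" for a b
    proof (cases "{inv \<sigma> b, inv \<sigma> a} = {k, Suc k}")
      case False
      have "inv \<sigma> b \<noteq> inv \<sigma> a"
        using \<open>a < b\<close> \<sigma> by (metis less_irrefl permutes_inverses(1))
      moreover have "\<not> (a = \<sigma> k \<and> b = \<sigma> (Suc k))"
        using False permutes_inverses(2)[OF \<sigma>] by auto
      ultimately show ?thesis
        using transpose_Suc_less_iff[OF _ False] inv by auto
    next
      case True
      then consider "inv \<sigma> b = k" "inv \<sigma> a = Suc k" | "inv \<sigma> b = Suc k" "inv \<sigma> a = k"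
        by (auto simp: doubleton_eq_iff)
      then show ?thesis
      proof cases
        case 1
        then have "a = \<sigma> (Suc k)" "b = \<sigma> k"
          using permutes_inverses(1)[OF \<sigma>] by metis+
        then show ?thesis using that asc by simp
      next
        case 2
        then have "a = \<sigma> k" "b = \<sigma> (Suc k)"
          using permutes_inverses(1)[OF \<sigma>] by metis+
        then show ?thesis using 2 inv by simp
      qed
    qed
    have "weak_le n \<sigma>' \<rho>"
    proof (rule less.hyps)
      show "card {(a, b) \<in> {1..n} \<times> {1..n}. a < b \<and> inv \<rho> b < inv \<rho> a \<and> \<not> inv \<sigma>' b < inv \<sigma>' a}
          < card {(a, b) \<in> {1..n} \<times> {1..n}. a < b \<and> inv \<rho> b < inv \<rho> a \<and> \<not> inv \<sigma> b < inv \<sigma> a}"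
      proof (rule psubset_card_mono)
        show "finite {(a, b) \<in> {1..n} \<times> {1..n}. a < b \<and> inv \<rho> b < inv \<rho> a \<and> \<not> inv \<sigma> b < inv \<sigma> a}"
          by (rule finite_subset[of _ "{1..n} \<times> {1..n}"]) auto
        have "k \<in> {1..n}" "Suc k \<in> {1..n}" using k by auto
        then have "\<sigma> k \<in> {1..n}" "\<sigma> (Suc k) \<in> {1..n}"
          using permutes_in_image[OF \<sigma>] by blast+
        then have "(\<sigma> k, \<sigma> (Suc k)) \<in> {(a, b) \<in> {1..n} \<times> {1..n}. a < b \<and> inv \<rho> b < inv \<rho> a \<and> \<not> inv \<sigma> b < inv \<sigma> a}"
          using asc invd permutes_inverses(2)[OF \<sigma>] by simp
        moreover have "(\<sigma> k, \<sigma> (Suc k)) \<notin> {(a, b) \<in> {1..n} \<times> {1..n}. a < b \<and> inv \<rho> b < inv \<rho> a \<and> \<not> inv \<sigma>' b < inv \<sigma>' a}"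
          using iff asc by simp
        moreover have "{(a, b) \<in> {1..n} \<times> {1..n}. a < b \<and> inv \<rho> b < inv \<rho> a \<and> \<not> inv \<sigma>' b < inv \<sigma>' a}
          \<subseteq> {(a, b) \<in> {1..n} \<times> {1..n}. a < b \<and> inv \<rho> b < inv \<rho> a \<and> \<not> inv \<sigma> b < inv \<sigma> a}"
          using iff by auto
        ultimately show "{(a, b) \<in> {1..n} \<times> {1..n}. a < b \<and> inv \<rho> b < inv \<rho> a \<and> \<not> inv \<sigma>' b < inv \<sigma>' a}
          \<subset> {(a, b) \<in> {1..n} \<times> {1..n}. a < b \<and> inv \<rho> b < inv \<rho> a \<and> \<not> inv \<sigma> b < inv \<sigma> a}" by blast
      qed
      show "inv \<rho> b < inv \<rho> a" if "a < b" "inv \<sigma>' b < inv \<sigma>' a" for a b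
        using that iff less.prems(2) invd by blast
    qed (rule \<sigma>')
    moreover have "weak_cover n \<sigma> \<sigma>'"
    proof -
      have "\<sigma> = \<sigma>' \<circ> transpose k (Suc k)" by (simp add: \<sigma>'_def o_assoc[symmetric])
      moreover have "k \<in> {1..n}" "Suc k \<in> {1..n}" "\<bar>int k - int (Suc k)\<bar> = 1" "k < Suc k"
        using k by auto
      ultimately show ?thesis
        unfolding weak_cover_def using \<sigma> \<sigma>' asc by blast
    qed
    ultimately show ?thesis
      unfolding weak_le_def by (meson converse_rtranclp_into_rtranclp)
  qed
qed

lemma weak_le_iff:
  assumes "\<sigma> permutes {1..n}" "\<rho> permutes {1..n}"
  shows "weak_le n \<sigma> \<rho> \<longleftrightarrow> (\<forall>a b. a < b \<longrightarrow> inv \<sigma> b < inv \<sigma> a \<longrightarrow> inv \<rho> b < inv \<rho> a)"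
  using assms inversions_imp_weak_le weak_le_imp_inversions by blast

section \<open>Linear extensions and the interval\<close>

definition lin_exts :: "('a \<Rightarrow> 'a \<Rightarrow> bool) \<Rightarrow> 'a set \<Rightarrow> 'a list set" where
  "lin_exts R S = {xs. distinct xs \<and> set xs = S \<and> sorted_wrt (\<lambda>x y. \<not> R y x) xs}"

lemma finite_lin_exts: "finite S \<Longrightarrow> finite (lin_exts R S)"
  by (rule finite_subset[OF _ finite_subset_distinct[of S]]) (auto simp: lin_exts_def)

lemma lin_exts_empty: "lin_exts R {} = {[]}"
  by (auto simp: lin_exts_def)

text \<open>The last element of an extension is maximal, and conversely a maximal element can be
  appended to every extension of the rest. Irreflexivity allows \<open>x\<close> itself among the
  \<open>y\<close> of the maximality test.\<close>

lemma card_lin_exts_rec: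
  assumes "finite S" "S \<noteq> {}" "\<And>x. \<not> R x x"
  shows "card (lin_exts R S) = (\<Sum>x | x \<in> S \<and> (\<forall>y\<in>S. \<not> R x y). card (lin_exts R (S - {x})))"
proof -
  let ?M = "{x. x \<in> S \<and> (\<forall>y\<in>S. \<not> R x y)}"
  have "lin_exts R S = (\<Union>x\<in>?M. (\<lambda>ys. ys @ [x]) ` lin_exts R (S - {x}))"
  proof (rule set_eqI)
    fix xs
    show "xs \<in> lin_exts R S \<longleftrightarrow> xs \<in> (\<Union>x\<in>?M. (\<lambda>ys. ys @ [x]) ` lin_exts R (S - {x}))"
      using assms(2,3)
      by (cases xs rule: rev_cases) (auto simp: lin_exts_def sorted_wrt_append)
  qed
  also have "card \<dots> = (\<Sum>x\<in>?M. card ((\<lambda>ys. ys @ [x]) ` lin_exts R (S - {x})))"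
    by (rule card_UN_disjoint) (auto intro!: finite_imageI finite_lin_exts assms(1) simp: assms(1))
  also have "\<dots> = (\<Sum>x\<in>?M. card (lin_exts R (S - {x})))"
    by (intro sum.cong refl card_image) (auto simp: inj_on_def)
  finally show ?thesis .
qed

text \<open>
  Elements of the poset are positions in \<open>\<sigma>\<^sub>1\<close>: for \<open>q = inv \<sigma>\<^sub>2 \<circ> \<sigma>\<^sub>1\<close>, the values \<open>\<sigma>\<^sub>1 i\<close> and
  \<open>\<sigma>\<^sub>1 j\<close> occur in this order in both words iff \<open>common_order q i j\<close>.
\<close>

definition common_order :: "(nat \<Rightarrow> nat) \<Rightarrow> nat \<Rightarrow> nat \<Rightarrow> bool" where
  "common_order q i j \<longleftrightarrow> i < j \<and> q i < q j"

text \<open>The inversions of \<open>\<rho>\<close> lie between those of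
  \<open>\<sigma>\<^sub>1\<close> and \<open>\<sigma>\<^sub>2\<close>. A pair inverted in
  \<open>\<sigma>\<^sub>1\<close> is inverted in both, a pair not inverted in
  \<open>\<sigma>\<^sub>2\<close> in neither; the two inclusions therefore fix exactly the pairs on
  which the ends agree.\<close>

lemma weak_interval_eq:
  assumes "\<sigma>\<^sub>1 permutes {1..n}" "\<sigma>\<^sub>2 permutes {1..n}" "weak_le n \<sigma>\<^sub>1 \<sigma>\<^sub>2"
  shows "weak_interval n \<sigma>\<^sub>1 \<sigma>\<^sub>2 = {\<rho>. \<rho> permutes {1..n} \<and>
    (\<forall>a b. inv \<sigma>\<^sub>1 a < inv \<sigma>\<^sub>1 b \<longrightarrow> inv \<sigma>\<^sub>2 a < inv \<sigma>\<^sub>2 b \<longrightarrow> inv \<rho> a < inv \<rho> b)}"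
proof -
  have *: "(\<forall>a b. a < b \<longrightarrow> i1 b < i1 a \<longrightarrow> r b < r a) \<and> (\<forall>a b. a < b \<longrightarrow> r b < r a \<longrightarrow> i2 b < i2 a)
      \<longleftrightarrow> (\<forall>a b. i1 a < i1 b \<longrightarrow> i2 a < i2 b \<longrightarrow> r a < r b)"
    if "inj i1" "inj i2" "inj r" "\<forall>a b. a < b \<longrightarrow> i1 b < i1 a \<longrightarrow> i2 b < i2 a"
    for i1 i2 r :: "nat \<Rightarrow> nat"
    using that unfolding inj_def by (metis nat_neq_iff less_not_sym)
  have "weak_le n \<sigma>\<^sub>1 \<rho> \<and> weak_le n \<rho> \<sigma>\<^sub>2 \<longleftrightarrow>
    (\<forall>a b. inv \<sigma>\<^sub>1 a < inv \<sigma>\<^sub>1 b \<longrightarrow> inv \<sigma>\<^sub>2 a < inv \<sigma>\<^sub>2 b \<longrightarrow> inv \<rho> a < inv \<rho> b)"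
    if "\<rho> permutes {1..n}" for \<rho>
    unfolding weak_le_iff[OF assms(1) that] weak_le_iff[OF that assms(2)]
    by (rule *) (use assms that in \<open>auto simp: weak_le_iff intro!: permutes_inj[OF permutes_inv]\<close>)
  then show ?thesis
    unfolding weak_interval_def by blast
qed

lemma distinct_list_permutes:
  fixes xs :: "nat list"
  assumes "distinct xs" "set xs = {1..n}"
  obtains \<tau> where "\<tau> permutes {1..n}" "map \<tau> [1..<Suc n] = xs"
proof
  have len: "length xs = n"
    using distinct_card[OF assms(1)] assms(2) by simp
  let ?\<tau> = "\<lambda>i. if i \<in> {1..n} then xs ! (i - 1) else i"
  have "bij_betw (\<lambda>i. xs ! (i - 1)) {1..n} {1..n}"
    unfolding bij_betw_def
  proof
    show inj: "inj_on (\<lambda>i. xs ! (i - 1)) {1..n}"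
      using assms(1) len by (auto simp: inj_on_def nth_eq_iff_index_eq)
    show "(\<lambda>i. xs ! (i - 1)) ` {1..n} = {1..n}"
    proof (rule endo_inj_surj[OF _ _ inj])
      have "xs ! (i - 1) \<in> set xs" if "i \<in> {1..n}" for i
        using that len by (intro nth_mem) auto
      then show "(\<lambda>i. xs ! (i - 1)) ` {1..n} \<subseteq> {1..n}"
        using assms(2) by blast
    qed simp
  qed
  then have "bij_betw ?\<tau> {1..n} {1..n}"
    by (subst bij_betw_cong[where g = "\<lambda>i. xs ! (i - 1)"]) auto
  then show "?\<tau> permutes {1..n}"
    by (rule bij_imp_permutes) auto
  show "map ?\<tau> [1..<Suc n] = xs"
    by (rule nth_equalityI) (auto simp: len simp del: upt_Suc)
qed

text \<open>The bijection relabels the word of \<open>\<rho>\<close> by the positions of its letters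
  in \<open>\<sigma>\<^sub>1\<close>.\<close>

lemma card_weak_interval:
  assumes "\<sigma>\<^sub>1 permutes {1..n}" "\<sigma>\<^sub>2 permutes {1..n}" "weak_le n \<sigma>\<^sub>1 \<sigma>\<^sub>2"
  shows "card (weak_interval n \<sigma>\<^sub>1 \<sigma>\<^sub>2) = card (lin_exts (common_order (inv \<sigma>\<^sub>2 \<circ> \<sigma>\<^sub>1)) {1..n})"
proof (rule bij_betw_same_card)
  let ?R = "common_order (inv \<sigma>\<^sub>2 \<circ> \<sigma>\<^sub>1)"
  let ?f = "\<lambda>\<rho>. map (inv \<sigma>\<^sub>1 \<circ> \<rho>) [1..<Suc n]"
  note inv1 = permutes_inverses[OF assms(1)]
  have ext_iff: "sorted_wrt (\<lambda>x y. \<not> ?R y x) (?f \<rho>) \<longleftrightarrow>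
      (\<forall>a b. inv \<sigma>\<^sub>1 a < inv \<sigma>\<^sub>1 b \<longrightarrow> inv \<sigma>\<^sub>2 a < inv \<sigma>\<^sub>2 b \<longrightarrow> inv \<rho> a < inv \<rho> b)"
    (is "?L = ?A") if \<rho>: "\<rho> permutes {1..n}" for \<rho>
  proof -
    note inv = permutes_inverses[OF \<rho>]
    have "?L \<longleftrightarrow> (\<forall>i j. 1 \<le> i \<longrightarrow> i < j \<longrightarrow> j \<le> n \<longrightarrow> \<not> ?R (inv \<sigma>\<^sub>1 (\<rho> j)) (inv \<sigma>\<^sub>1 (\<rho> i)))"
      unfolding sorted_wrt_map
    proof
      assume L: "sorted_wrt (\<lambda>x y. \<not> ?R ((inv \<sigma>\<^sub>1 \<circ> \<rho>) y) ((inv \<sigma>\<^sub>1 \<circ> \<rho>) x)) [1..<Suc n]"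
      show "\<forall>i j. 1 \<le> i \<longrightarrow> i < j \<longrightarrow> j \<le> n \<longrightarrow> \<not> ?R (inv \<sigma>\<^sub>1 (\<rho> j)) (inv \<sigma>\<^sub>1 (\<rho> i))"
      proof (intro allI impI)
        fix i j :: nat assume "1 \<le> i" "i < j" "j \<le> n"
        then show "\<not> ?R (inv \<sigma>\<^sub>1 (\<rho> j)) (inv \<sigma>\<^sub>1 (\<rho> i))"
          using sorted_wrt_nth_less[OF L, of "i - 1" "j - 1"] by (simp del: upt_Suc)
      qed
    next
      assume "\<forall>i j. 1 \<le> i \<longrightarrow> i < j \<longrightarrow> j \<le> n \<longrightarrow> \<not> ?R (inv \<sigma>\<^sub>1 (\<rho> j)) (inv \<sigma>\<^sub>1 (\<rho> i))"
      then show "sorted_wrt (\<lambda>x y. \<not> ?R ((inv \<sigma>\<^sub>1 \<circ> \<rho>) y) ((inv \<sigma>\<^sub>1 \<circ> \<rho>) x)) [1..<Suc n]"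
        by (auto simp: sorted_wrt_iff_nth_less simp del: upt_Suc)
    qed
    also have "\<dots> \<longleftrightarrow> ?A"
    proof
      assume L: "\<forall>i j. 1 \<le> i \<longrightarrow> i < j \<longrightarrow> j \<le> n \<longrightarrow> \<not> ?R (inv \<sigma>\<^sub>1 (\<rho> j)) (inv \<sigma>\<^sub>1 (\<rho> i))"
      show ?A
      proof (intro allI impI, rule ccontr)
        fix a b assume ab: "inv \<sigma>\<^sub>1 a < inv \<sigma>\<^sub>1 b" "inv \<sigma>\<^sub>2 a < inv \<sigma>\<^sub>2 b" "\<not> inv \<rho> a < inv \<rho> b"
        then have "a \<noteq> b" by auto
        then have "inv \<rho> a \<noteq> inv \<rho> b" using inv(1) by metis
        with ab have lt: "inv \<rho> b < inv \<rho> a" by simp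
        \<comment> \<open>Points outside \<open>{1..n}\<close> are fixed by both inverses, and
          points inside stay inside, so a pair with an outside point is ordered alike by
          \<open>inv \<sigma>\<^sub>1\<close> and \<open>inv \<rho>\<close>.\<close>
        have "a \<in> {1..n} \<and> b \<in> {1..n}"
        proof (rule ccontr)
          assume out: "\<not> (a \<in> {1..n} \<and> b \<in> {1..n})"
          have img: "inv p x \<in> {1..n} \<longleftrightarrow> x \<in> {1..n}" "x \<notin> {1..n} \<Longrightarrow> inv p x = x" if "p permutes {1..n}" for p x
            using permutes_in_image[OF permutes_inv[OF that]] permutes_not_in[OF permutes_inv[OF that]] by auto
          show False
            using out ab(1) lt img[OF assms(1), of a] img[OF assms(1), of b] img[OF \<rho>, of a] img[OF \<rho>, of b]
            by (cases "a \<in> {1..n}"; cases "b \<in> {1..n}") auto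
        qed
        then have "inv \<rho> a \<in> {1..n}" "inv \<rho> b \<in> {1..n}"
          using permutes_in_image[OF permutes_inv[OF \<rho>]] by blast+
        then have "\<not> ?R (inv \<sigma>\<^sub>1 (\<rho> (inv \<rho> a))) (inv \<sigma>\<^sub>1 (\<rho> (inv \<rho> b)))"
          using L lt by simp
        then show False
          using ab inv inv1 by (simp add: common_order_def)
      qed
    next
      assume A: ?A
      show "\<forall>i j. 1 \<le> i \<longrightarrow> i < j \<longrightarrow> j \<le> n \<longrightarrow> \<not> ?R (inv \<sigma>\<^sub>1 (\<rho> j)) (inv \<sigma>\<^sub>1 (\<rho> i))"
        using A inv inv1 by (metis common_order_def comp_apply less_not_sym)
    qed
    finally show ?thesis .
  qed
  show "bij_betw ?f (weak_interval n \<sigma>\<^sub>1 \<sigma>\<^sub>2) (lin_exts ?R {1..n})"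
    unfolding weak_interval_eq[OF assms] bij_betw_def
  proof
    let ?U = "{\<rho>. \<rho> permutes {1..n} \<and>
      (\<forall>a b. inv \<sigma>\<^sub>1 a < inv \<sigma>\<^sub>1 b \<longrightarrow> inv \<sigma>\<^sub>2 a < inv \<sigma>\<^sub>2 b \<longrightarrow> inv \<rho> a < inv \<rho> b)}"
    show "inj_on ?f ?U"
    proof (rule inj_onI)
      fix \<rho> \<rho>' assume U: "\<rho> \<in> ?U" "\<rho>' \<in> ?U" and eq: "?f \<rho> = ?f \<rho>'"
      have "\<rho> x = \<rho>' x" for x
      proof (cases "x \<in> {1..n}")
        case True
        then have "inv \<sigma>\<^sub>1 (\<rho> x) = inv \<sigma>\<^sub>1 (\<rho>' x)"
          using eq by (auto simp: map_eq_conv simp del: upt_Suc)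
        then show ?thesis using inv1 by metis
      next
        case False
        then show ?thesis
          using U permutes_not_in[of \<rho> "{1..n}" x] permutes_not_in[of \<rho>' "{1..n}" x] by simp
      qed
      then show "\<rho> = \<rho>'" by blast
    qed
    show "?f ` ?U = lin_exts ?R {1..n}"
    proof (intro equalityI subsetI)
      fix xs assume "xs \<in> ?f ` ?U"
      then obtain \<rho> where \<rho>: "\<rho> \<in> ?U" "xs = ?f \<rho>" by blast
      then have p: "inv \<sigma>\<^sub>1 \<circ> \<rho> permutes {1..n}"
        using assms(1) by (auto intro: permutes_compose permutes_inv)
      have "distinct xs"
        using permutes_inj_on[OF p] \<rho>(2) by (simp add: distinct_map atLeastLessThanSuc_atLeastAtMost del: upt_Suc)
      moreover have "set xs = {1..n}"
        using permutes_image[OF p] \<rho>(2) by (simp add: atLeastLessThanSuc_atLeastAtMost del: upt_Suc)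
      ultimately show "xs \<in> lin_exts ?R {1..n}"
        using \<rho> ext_iff unfolding lin_exts_def by blast
    next
      fix xs assume xs: "xs \<in> lin_exts ?R {1..n}"
      then obtain \<tau> where \<tau>: "\<tau> permutes {1..n}" "map \<tau> [1..<Suc n] = xs"
        using distinct_list_permutes[of xs n] unfolding lin_exts_def by blast
      have eq: "?f (\<sigma>\<^sub>1 \<circ> \<tau>) = xs"
        using \<tau>(2) inv1 by (simp add: o_def del: upt_Suc)
      have "\<sigma>\<^sub>1 \<circ> \<tau> permutes {1..n}"
        using assms(1) \<tau>(1) by (intro permutes_compose)
      then have "\<sigma>\<^sub>1 \<circ> \<tau> \<in> ?U"
        using xs eq ext_iff[of "\<sigma>\<^sub>1 \<circ> \<tau>"] unfolding lin_exts_def by auto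
      with eq show "xs \<in> ?f ` ?U" by blast
    qed
  qed
qed

lemma card_weak_interval_empty:
  assumes "\<not> weak_le n \<sigma>\<^sub>1 \<sigma>\<^sub>2"
  shows "card (weak_interval n \<sigma>\<^sub>1 \<sigma>\<^sub>2) = 0"
proof -
  have "weak_interval n \<sigma>\<^sub>1 \<sigma>\<^sub>2 = {}"
    using assms unfolding weak_interval_def weak_le_def by (auto dest: rtranclp_trans)
  then show ?thesis by simp
qed

section \<open>Chain decomposition and the recursion on prefixes\<close>

definition radix :: "(nat \<Rightarrow> nat) \<Rightarrow> nat \<Rightarrow> nat" where
  "radix s p = (\<Prod>j<p. Suc (s j))"

text \<open>Digit \<open>p\<close> has base \<open>Suc (s p)\<close>, so the tuples bounded by
  \<open>s\<close> are numbered from 0 up to \<open>radix s m - 1\<close>.\<close>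

definition mixed :: "(nat \<Rightarrow> nat) \<Rightarrow> nat \<Rightarrow> (nat \<Rightarrow> nat) \<Rightarrow> nat" where
  "mixed s m d = (\<Sum>p<m. d p * radix s p)"

lemma radix_0 [simp]: "radix s 0 = 1"
  and radix_Suc: "radix s (Suc p) = radix s p * Suc (s p)"
  by (simp_all add: radix_def)

lemma radix_pos [simp]: "0 < radix s p"
  by (simp add: radix_def prod_pos)

lemma radix_nonzero [simp]: "radix s p \<noteq> 0"
  using radix_pos[of s p] by simp

lemma mixed_less: "\<forall>p<m. d p \<le> s p \<Longrightarrow> mixed s m d < radix s m"
proof (induction m)
  case (Suc m)
  then have "mixed s m d < radix s m" by simp
  moreover have "d m * radix s m \<le> s m * radix s m"
    using Suc.prems by (intro mult_right_mono) auto
  ultimately have "mixed s m d + d m * radix s m < radix s m + s m * radix s m"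
    by (rule add_less_le_mono)
  then show ?case
    by (simp add: mixed_def radix_Suc mult.commute[of "radix s m"])
qed (simp add: mixed_def)

text \<open>The tuple of full chains has the last index; this is the table entry that is
  output.\<close>

lemma mixed_max: "Suc (mixed s m s) = radix s m"
  by (induction m) (auto simp: mixed_def radix_Suc algebra_simps)

lemma mixed_inj:
  assumes "\<forall>p<m. d p \<le> s p" "\<forall>p<m. d' p \<le> s p" "mixed s m d = mixed s m d'" "p < m"
  shows "d p = d' p"
  using assms
proof (induction m)
  case (Suc m)
  have lt: "mixed s m d < radix s m" "mixed s m d' < radix s m"
    using Suc.prems by (auto intro: mixed_less)
  have eq: "mixed s m d + d m * radix s m = mixed s m d' + d' m * radix s m"
    using Suc.prems by (simp add: mixed_def)
  have "d m = d' m"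
    using arg_cong[OF eq, of "\<lambda>x. x div radix s m"] lt by simp
  with eq Suc show ?case by (cases "p = m") auto
qed simp

text \<open>Stated with sums to avoid truncated subtraction. It serves both the lookup of a lowered
  digit and the carry of the counter.\<close>

lemma mixed_upd:
  assumes "p < m"
  shows "mixed s m (d(p := v)) + d p * radix s p = mixed s m d + v * radix s p"
proof -
  have "(\<Sum>j\<in>{..<m} - {p}. (d(p := v)) j * radix s j) = (\<Sum>j\<in>{..<m} - {p}. d j * radix s j)"
    by (rule sum.cong) auto
  then show ?thesis
    using assms by (simp add: mixed_def sum.remove[of "{..<m}" p])
qed

lemma mixed_eq_0_iff: "mixed s m d = 0 \<longleftrightarrow> (\<forall>p<m. d p = 0)"
  by (auto simp: mixed_def)

text \<open>
  \<open>Suc (lev q i)\<close> is the length of a longest decreasing subsequence of \<open>q\<close> ending at position \<open>i\<close>,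
  so elements of equal level form a chain of the common order.
\<close>

function lev :: "(nat \<Rightarrow> nat) \<Rightarrow> nat \<Rightarrow> nat" where
  "lev q i = Max (insert 0 ((\<lambda>j. Suc (lev q j)) ` {j \<in> {1..<i}. q i < q j}))"
  by auto
termination by (relation "measure snd") auto

declare lev.simps [simp del]

lemma lev_less: "j \<in> {1..<i} \<Longrightarrow> q i < q j \<Longrightarrow> lev q j < lev q i"
  unfolding lev.simps[of q i] Suc_le_eq[symmetric] by (rule Max_ge) auto

lemma lev_cases:
  obtains "lev q i = 0" | j where "j \<in> {1..<i}" "q i < q j" "lev q i = Suc (lev q j)"
proof -
  have "lev q i \<in> insert 0 ((\<lambda>j. Suc (lev q j)) ` {j \<in> {1..<i}. q i < q j})"
    by (subst lev.simps, rule Max_in) auto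
  then show ?thesis using that by auto
qed

lemma lev_lt: "1 \<le> i \<Longrightarrow> lev q i < i"
proof (induction i rule: less_induct)
  case (less i)
  show ?case
    by (cases rule: lev_cases[of q i]) (use less in force)+
qed

text \<open>The inserted 0 gives the value for \<open>n = 0\<close>, which is the initial value of
  the program's variable \<open>m\<close>.\<close>

definition levels :: "(nat \<Rightarrow> nat) \<Rightarrow> nat \<Rightarrow> nat" where
  "levels q n = Max (insert 0 ((\<lambda>j. Suc (lev q j)) ` {1..n}))"

lemma levels_0 [simp]: "levels q 0 = 0"
  by (simp add: levels_def)

lemma levels_Suc: "levels q (Suc n) = max (levels q n) (Suc (lev q (Suc n)))"
  by (simp add: levels_def atLeastAtMostSuc_conv insert_commute[of 0] max.commute)

lemma lev_less_levels: "i \<in> {1..n} \<Longrightarrow> lev q i < levels q n"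
  unfolding levels_def Suc_le_eq[symmetric] by (rule Max_ge) auto

text \<open>Follow the predecessors that attain the maximum: each lowers the level by exactly one.
  Hence no level below \<open>levels\<close> is empty.\<close>

lemma lev_downward: "1 \<le> i \<Longrightarrow> p \<le> lev q i \<Longrightarrow> \<exists>j\<in>{1..i}. lev q j = p"
proof (induction i rule: less_induct)
  case (less i)
  show ?case
  proof (cases "p = lev q i")
    case False
    with less.prems obtain j where j: "j \<in> {1..<i}" "lev q i = Suc (lev q j)"
      by (cases rule: lev_cases[of q i]) auto
    then show ?thesis using less.IH[of j] less.prems False by fastforce
  qed (use less in auto)
qed

lemma levels_obtain:
  assumes "p < levels q n"
  obtains i where "i \<in> {1..n}" "lev q i = p"
proof -
  have "levels q n \<in> insert 0 ((\<lambda>j. Suc (lev q j)) ` {1..n})"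
    unfolding levels_def by (rule Max_in) auto
  then obtain i where "i \<in> {1..n}" "p \<le> lev q i" using assms by auto
  then show ?thesis using lev_downward[of i p q] that by fastforce
qed

text \<open>The width is that of \<open>inv q\<close>, so the decreasing run of \<open>q\<close> is
  read through the inverse: its values, in increasing order, become positions, and its positions
  become a decreasing sequence of values.\<close>

lemma lev_decreasing_list:
  assumes "q permutes {1..n}" "i \<in> {1..n}"
  shows "\<exists>ps. length (q i # ps) = Suc (lev q i) \<and> set ps \<subseteq> {1..n} \<and>
    sorted_wrt (<) (q i # ps) \<and> sorted_wrt (>) (map (inv q) (q i # ps))"
  using assms(2)
proof (induction i rule: less_induct)
  case (less i)
  show ?case
  proof (cases rule: lev_cases[of q i])
    case 1
    then show ?thesis by (intro exI[of _ "[]"]) simp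
  next
    case (2 j)
    then obtain ps where ps: "length (q j # ps) = Suc (lev q j)" "set ps \<subseteq> {1..n}"
      "sorted_wrt (<) (q j # ps)" "sorted_wrt (>) (map (inv q) (q j # ps))"
      using less.IH[of j] less.prems by auto
    have "q j \<in> {1..n}" using permutes_in_image[OF assms(1), of j] 2 less.prems by simp
    then have "sorted_wrt (<) (q i # q j # ps) \<and> sorted_wrt (>) (map (inv q) (q i # q j # ps))"
      using ps 2 permutes_inverses(2)[OF assms(1)] by fastforce
    then show ?thesis
      using ps 2 \<open>q j \<in> {1..n}\<close> by (intro exI[of _ "q j # ps"]) simp
  qed
qed

lemma levels_le_width:
  assumes "q permutes {1..n}"
  shows "levels q n \<le> width n (inv q)"
proof (cases "levels q n")
  case (Suc p)
  then obtain i where i: "i \<in> {1..n}" "lev q i = p"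
    using levels_obtain[of p q n] by auto
  obtain ps where ps: "length (q i # ps) = Suc p" "set ps \<subseteq> {1..n}"
    "sorted_wrt (<) (q i # ps)" "sorted_wrt (>) (map (inv q) (q i # ps))"
    using lev_decreasing_list[OF assms i(1)] i(2) by auto
  have "q i \<in> {1..n}" using permutes_in_image[OF assms, of i] i by simp
  then have "subseq (q i # ps) [1..<Suc n]"
    using ps by (intro sorted_subset_imp_subseq)
      (auto simp: strict_sorted_iff atLeastLessThanSuc_atLeastAtMost simp del: upt_Suc)
  then have "subseq (map (inv q) (q i # ps)) (one_line n (inv q))"
    unfolding one_line_def by (rule subseq_map)
  then have "length (map (inv q) (q i # ps)) \<in>
      {length xs | xs. subseq xs (one_line n (inv q)) \<and> sorted_wrt (>) xs}"
    using ps(4) by blast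
  moreover have "finite {length xs | xs. subseq xs (one_line n (inv q)) \<and> sorted_wrt (>) xs}"
    by (rule finite_subset[of _ "{..length (one_line n (inv q))}"]) (auto dest: list_emb_length)
  ultimately have "length (map (inv q) (q i # ps)) \<le> width n (inv q)"
    unfolding width_def by (rule Max_ge[rotated])
  then show ?thesis using Suc ps by simp
qed simp

section \<open>Chains of equal level\<close>

definition chain :: "(nat \<Rightarrow> nat) \<Rightarrow> nat \<Rightarrow> nat \<Rightarrow> nat list" where
  "chain q n p = filter (\<lambda>i. lev q i = p) [1..<Suc n]"

lemma set_chain: "set (chain q n p) = {i \<in> {1..n}. lev q i = p}"
  by (auto simp: chain_def)

lemma chain_0 [simp]: "chain q 0 p = []"
  by (simp add: chain_def)

lemma chain_Suc: "chain q (Suc n) p = chain q n p @ (if lev q (Suc n) = p then [Suc n] else [])"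
  by (simp add: chain_def)

lemma length_chain: "length (chain q n p) \<le> n"
  using length_filter_le[of "\<lambda>i. lev q i = p" "[1..<Suc n]"] by (simp add: chain_def del: upt_Suc)

lemma sorted_chain: "sorted_wrt (<) (chain q n p)"
  unfolding chain_def by (rule sorted_wrt_filter) (simp del: upt_Suc)

text \<open>An inversion of \<open>q\<close> would give the later of two positions a higher level,
  so two positions of equal level are ordered alike by position and by \<open>q\<close>.\<close>

lemma chain_common_order:
  assumes "inj q" "a < b" "b < length (chain q n p)"
  shows "common_order q (chain q n p ! a) (chain q n p ! b)"
proof -
  let ?x = "chain q n p ! a" and ?y = "chain q n p ! b"
  have lt: "?x < ?y" using sorted_chain assms(2,3) by (rule sorted_wrt_nth_less)
  have "?x \<in> {i \<in> {1..n}. lev q i = p}" "?y \<in> {i \<in> {1..n}. lev q i = p}"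
    using assms unfolding set_chain[symmetric] by auto
  then have "\<not> q ?y < q ?x" using lev_less[of ?x ?y q] lt by auto
  moreover have "q ?x \<noteq> q ?y" using lt injD[OF assms(1)] by fastforce
  ultimately show ?thesis using lt by (simp add: common_order_def)
qed

text \<open>
  With at least two nonempty chains each chain has at most \<open>n - 1\<close> elements, so the factor 2 is
  only needed for a single chain.
\<close>

lemma radix_chain_le:
  assumes "1 \<le> n"
  shows "radix (\<lambda>p. length (chain q n p)) (levels q n) \<le> 2 * n ^ levels q n"
proof (cases "levels q n \<le> 1")
  case True
  have "lev q 1 < levels q n" using assms by (intro lev_less_levels) auto
  with True have "levels q n = 1" by simp
  then show ?thesis using length_chain[of q n 0] assms by (simp add: radix_def)
next
  case False
  have "Suc (length (chain q n p)) \<le> n" if "p < levels q n" for p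
  proof -
    \<comment> \<open>Some level other than \<open>p\<close>; an element of it is missing from chain
      \<open>p\<close>, which therefore has fewer than \<open>n\<close> elements.\<close>
    define p' :: nat where "p' = (if p = 0 then 1 else 0)"
    then have "p' < levels q n" using False by simp
    then obtain i where i: "i \<in> {1..n}" "lev q i = p'"
      using levels_obtain by blast
    have "distinct (chain q n p)" by (simp add: chain_def)
    then have "length (chain q n p) = card {i \<in> {1..n}. lev q i = p}"
      by (metis distinct_card set_chain)
    also have "\<dots> < card {1..n}"
    proof (intro psubset_card_mono psubsetI)
      have "i \<notin> {i \<in> {1..n}. lev q i = p}"
        using i by (simp add: p'_def split: if_splits)
      then show "{i \<in> {1..n}. lev q i = p} \<noteq> {1..n}" using i by blast
    qed auto
    finally show ?thesis by simp
  qed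
  then have "radix (\<lambda>p. length (chain q n p)) (levels q n) \<le> (\<Prod>p<levels q n. n)"
    unfolding radix_def by (intro prod_mono) auto
  then show ?thesis by simp
qed

section \<open>The recursion on tuples of prefixes\<close>

definition prefixes :: "(nat \<Rightarrow> nat) \<Rightarrow> nat \<Rightarrow> (nat \<Rightarrow> nat) \<Rightarrow> nat set" where
  "prefixes q n d = (\<Union>p<levels q n. set (take (d p) (chain q n p)))"

abbreviation top_of :: "(nat \<Rightarrow> nat) \<Rightarrow> nat \<Rightarrow> (nat \<Rightarrow> nat) \<Rightarrow> nat \<Rightarrow> nat" where
  "top_of q n d p \<equiv> chain q n p ! (d p - 1)"

definition removable :: "(nat \<Rightarrow> nat) \<Rightarrow> nat \<Rightarrow> (nat \<Rightarrow> nat) \<Rightarrow> nat \<Rightarrow> bool" where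
  "removable q n d p \<longleftrightarrow> 0 < d p \<and>
    (\<forall>r<levels q n. 0 < d r \<longrightarrow> \<not> common_order q (top_of q n d p) (top_of q n d r))"

lemma prefixes_full: "prefixes q n (\<lambda>p. length (chain q n p)) = {1..n}"
  using lev_less_levels[of _ n q] by (auto simp: prefixes_def set_chain)

lemma lev_chain_nth: "r < length (chain q n p) \<Longrightarrow> lev q (chain q n p ! r) = p"
  using nth_mem[of r "chain q n p"] by (simp add: set_chain)

lemma prefixes_iff:
  assumes "\<forall>p<levels q n. d p \<le> length (chain q n p)"
  shows "x \<in> prefixes q n d \<longleftrightarrow> (\<exists>p<levels q n. \<exists>r<d p. x = chain q n p ! r)"
  using assms by (force simp: prefixes_def in_set_conv_nth)

text \<open>
  The set of prefixes need not be a down-set of the common order. The recursion holds nevertheless,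
  as a maximal element of it is the top of a prefix and is only to be compared with the other tops.
\<close>

lemma card_lin_exts_prefixes:
  assumes "inj q" and d: "\<forall>p<levels q n. d p \<le> length (chain q n p)"
  shows "card (lin_exts (common_order q) (prefixes q n d)) =
    (if \<forall>p<levels q n. d p = 0 then 1 else 0) +
    (\<Sum>p | p < levels q n \<and> removable q n d p.
      card (lin_exts (common_order q) (prefixes q n (d(p := d p - 1)))))"
proof (cases "\<forall>p<levels q n. d p = 0")
  case True
  then have "prefixes q n d = {}" by (simp add: prefixes_def)
  moreover have none: "{p. p < levels q n \<and> removable q n d p} = {}"
    using True by (auto simp: removable_def)
  ultimately show ?thesis
    using True by (simp only: none lin_exts_empty) simp
next
  case False
  let ?m = "levels q n" and ?R = "common_order q" and ?S = "prefixes q n d"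
    and ?top = "top_of q n d" and ?P = "{p. p < levels q n \<and> removable q n d p}"
  have top_in: "?top p \<in> ?S" if "p < ?m" "0 < d p" for p
    unfolding prefixes_iff[OF d] using that by (intro exI[of _ p]) (auto intro!: exI[of _ "d p - 1"])
  have lev_top: "lev q (?top p) = p" if "p < ?m" "0 < d p" for p
    using that d by (intro lev_chain_nth) fastforce
  have inj: "inj_on ?top ?P"
    by (rule inj_on_inverseI[of _ "lev q"]) (use lev_top in \<open>auto simp: removable_def\<close>)
  \<comment> \<open>This is why comparing the tops suffices: anything above \<open>x\<close> in some
    prefix lies at or below the top of that prefix.\<close>
  have below_top: "x = ?top p \<or> ?R x (?top p)" if "p < ?m" "x = chain q n p ! r" "r < d p" for x p r
    using chain_common_order[OF assms(1), of r "d p - 1" n p] that d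
    by (cases "r = d p - 1") (force simp: less_Suc_eq_le)+
  have "finite ?S" by (simp add: prefixes_def)
  moreover have "?S \<noteq> {}" using False top_in by blast
  ultimately have "card (lin_exts ?R ?S) =
      (\<Sum>x | x \<in> ?S \<and> (\<forall>y\<in>?S. \<not> ?R x y). card (lin_exts ?R (?S - {x})))"
    by (rule card_lin_exts_rec) (simp add: common_order_def)
  also have "{x. x \<in> ?S \<and> (\<forall>y\<in>?S. \<not> ?R x y)} = ?top ` ?P"
  proof (intro equalityI subsetI)
    fix x assume x: "x \<in> {x. x \<in> ?S \<and> (\<forall>y\<in>?S. \<not> ?R x y)}"
    then obtain p r where p: "p < ?m" "x = chain q n p ! r" "r < d p"
      using prefixes_iff[OF d] by blast
    then have "x = ?top p" using below_top[OF p] x top_in[of p] by auto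
    moreover have "removable q n d p"
      using x p top_in \<open>x = ?top p\<close> by (auto simp: removable_def)
    ultimately show "x \<in> ?top ` ?P" using p by blast
  next
    fix x assume "x \<in> ?top ` ?P"
    then obtain p where p: "p < ?m" "removable q n d p" "x = ?top p" by blast
    have "\<not> ?R x y" if y: "y \<in> ?S" for y
    proof
      assume "?R x y"
      obtain r k where r: "r < ?m" "y = chain q n r ! k" "k < d r"
        using prefixes_iff[OF d] y by blast
      then have "?R x (?top r)"
        using below_top[OF r] \<open>?R x y\<close> by (auto simp: common_order_def)
      then show False using p r by (auto simp: removable_def)
    qed
    then show "x \<in> {x. x \<in> ?S \<and> (\<forall>y\<in>?S. \<not> ?R x y)}"
      using p top_in by (auto simp: removable_def)
  qed
  also have "(\<Sum>x\<in>?top ` ?P. card (lin_exts ?R (?S - {x}))) =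
      (\<Sum>p\<in>?P. card (lin_exts ?R (prefixes q n (d(p := d p - 1)))))"
  proof (subst sum.reindex[OF inj], rule sum.cong)
    fix p assume "p \<in> ?P"
    then have p: "p < ?m" "0 < d p" by (auto simp: removable_def)
    have d': "\<forall>r<?m. (d(p := d p - 1)) r \<le> length (chain q n r)"
      using d by (auto intro: le_trans[OF diff_le_self])
    have "?S - {?top p} = prefixes q n (d(p := d p - 1))"
    proof (intro equalityI subsetI)
      fix x assume x: "x \<in> ?S - {?top p}"
      then obtain r k where r: "r < ?m" "k < d r" "x = chain q n r ! k"
        using prefixes_iff[OF d] by blast
      then have "k < (d(p := d p - 1)) r" using x by (auto simp: less_diff_conv) (metis One_nat_def Suc_lessI diff_Suc_1)
      with r show "x \<in> prefixes q n (d(p := d p - 1))"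
        unfolding prefixes_iff[OF d'] by blast
    next
      fix x assume "x \<in> prefixes q n (d(p := d p - 1))"
      then obtain r k where r: "r < ?m" "k < (d(p := d p - 1)) r" "x = chain q n r ! k"
        unfolding prefixes_iff[OF d'] by blast
      then have k: "k < d r" by (auto split: if_splits)
      have "x \<noteq> ?top p"
      proof
        assume "x = ?top p"
        then have "r = p" using lev_top[OF p] lev_chain_nth[of k q n r] r k d by fastforce
        then have "k < d p - 1" "d p \<le> length (chain q n p)" using r d p by auto
        moreover from this have "d p - 1 < length (chain q n p)" by linarith
        ultimately have "common_order q (chain q n p ! k) (?top p)"
          by (intro chain_common_order[OF assms(1)])
        then show False
          using r \<open>r = p\<close> \<open>x = ?top p\<close> by (simp add: common_order_def)
      qed
      then show "x \<in> ?S - {?top p}" using r k unfolding Diff_iff prefixes_iff[OF d] by blast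
    qed
    then show "((\<lambda>x. card (lin_exts ?R (?S - {x}))) \<circ> ?top) p =
        card (lin_exts ?R (prefixes q n (d(p := d p - 1))))" by simp
  qed simp
  finally show ?thesis using False by simp
qed

section \<open>Programs with time bounds\<close>

notation Seq (infixr ";;" 60)

section \<open>Total correctness with time bounds\<close>

definition runs :: "com \<Rightarrow> state \<Rightarrow> nat \<Rightarrow> (state \<Rightarrow> bool) \<Rightarrow> bool" where
  "runs c s T Q \<longleftrightarrow> (\<exists>t s'. exec c s t s' \<and> t \<le> T \<and> Q s')"

lemma runsI: "exec c s t s' \<Longrightarrow> t \<le> T \<Longrightarrow> Q s' \<Longrightarrow> runs c s T Q"
  unfolding runs_def by blast

lemma runs_weaken:
  "runs c s T P \<Longrightarrow> (\<And>s'. P s' \<Longrightarrow> Q s') \<Longrightarrow> T \<le> T' \<Longrightarrow> runs c s T' Q"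
  unfolding runs_def by (meson le_trans)

lemma runs_Seq:
  assumes "runs c\<^sub>1 s T\<^sub>1 P" "\<And>s'. P s' \<Longrightarrow> runs c\<^sub>2 s' T\<^sub>2 Q"
  shows "runs (c\<^sub>1 ;; c\<^sub>2) s (T\<^sub>1 + T\<^sub>2) Q"
  using assms unfolding runs_def by (meson add_mono exec.Seq)

text \<open>The measure \<open>\<mu>\<close> bounds the number of iterations, each paying
  \<open>K\<close> for the body and \<open>B\<close> for the test; the last \<open>B\<close> pays
  for the failing test.\<close>

lemma runs_While:
  fixes \<mu> :: "state \<Rightarrow> nat"
  assumes "I s"
    and body: "\<And>s. I s \<Longrightarrow> bval b s \<Longrightarrow> runs c s K (\<lambda>s'. I s' \<and> \<mu> s' < \<mu> s)"
    and "\<And>s. I s \<Longrightarrow> \<not> bval b s \<Longrightarrow> Q s" "\<mu> s \<le> L" "1 + bcost b \<le> B"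
  shows "runs (While b c) s (L * (K + B) + B) Q"
  using assms(1,4)
proof (induction L arbitrary: s)
  case 0
  then have "\<not> bval b s" using body[of s] by (auto simp: runs_def)
  then have "exec (While b c) s (1 + bcost b) s" by (rule exec.WhileFalse)
  then show ?case using assms(3,5) 0 \<open>\<not> bval b s\<close> unfolding runs_def by (metis add_0 mult_0)
next
  case (Suc L)
  show ?case
  proof (cases "bval b s")
    case False
    then have "exec (While b c) s (1 + bcost b) s" by (rule exec.WhileFalse)
    then show ?thesis using assms(3,5) Suc.prems False unfolding runs_def by (meson trans_le_add2)
  next
    case True
    obtain t\<^sub>1 s' where 1: "exec c s t\<^sub>1 s'" "t\<^sub>1 \<le> K" "I s'" "\<mu> s' < \<mu> s"
      using body[OF Suc.prems(1) True] by (auto simp: runs_def)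
    then obtain t\<^sub>2 s'' where 2: "exec (While b c) s' t\<^sub>2 s''" "t\<^sub>2 \<le> L * (K + B) + B" "Q s''"
      using Suc.IH[of s'] Suc.prems by (auto simp: runs_def)
    have "exec (While b c) s (1 + bcost b + t\<^sub>1 + t\<^sub>2) s''"
      using True 1(1) 2(1) by (rule exec.WhileTrue)
    moreover have "1 + bcost b + t\<^sub>1 + t\<^sub>2 \<le> Suc L * (K + B) + B"
      using 1(2) 2(2) assms(5) by simp
    ultimately show ?thesis using 2 unfolding runs_def by blast
  qed
qed

definition upd :: "vname \<Rightarrow> nat \<Rightarrow> state \<Rightarrow> state" where
  "upd x v s = ((fst s)(x := v), snd s)"

text \<open>Loop-free code can be evaluated by simplification through \<open>result\<close> and
  \<open>cost\<close>, with the dearer branch charged, so invariants are required for loops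
  only.\<close>

fun straight :: "com \<Rightarrow> bool" where
  "straight (Seq c\<^sub>1 c\<^sub>2) \<longleftrightarrow> straight c\<^sub>1 \<and> straight c\<^sub>2"
| "straight (Cond b c\<^sub>1 c\<^sub>2) \<longleftrightarrow> straight c\<^sub>1 \<and> straight c\<^sub>2"
| "straight (While b c) \<longleftrightarrow> False"
| "straight _ \<longleftrightarrow> True"

fun result :: "com \<Rightarrow> state \<Rightarrow> state" where
  "result Skip s = s"
| "result (Assign x a) s = upd x (aval a s) s"
| "result (Store a e) s = (fst s, (snd s)(aval a s := aval e s))"
| "result (Seq c\<^sub>1 c\<^sub>2) s = result c\<^sub>2 (result c\<^sub>1 s)"
| "result (Cond b c\<^sub>1 c\<^sub>2) s = (if bval b s then result c\<^sub>1 s else result c\<^sub>2 s)"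
| "result (While b c) s = s"

fun cost :: "com \<Rightarrow> nat" where
  "cost Skip = 1"
| "cost (Assign x a) = 1 + acost a"
| "cost (Store a e) = 1 + acost a + acost e"
| "cost (Seq c\<^sub>1 c\<^sub>2) = cost c\<^sub>1 + cost c\<^sub>2"
| "cost (Cond b c\<^sub>1 c\<^sub>2) = 1 + bcost b + max (cost c\<^sub>1) (cost c\<^sub>2)"
| "cost (While b c) = 0"

lemma runs_straight_result: "straight c \<Longrightarrow> runs c s (cost c) (\<lambda>s'. s' = result c s)"
proof (induction c arbitrary: s)
  case (Seq c\<^sub>1 c\<^sub>2)
  have "runs (c\<^sub>1 ;; c\<^sub>2) s (cost c\<^sub>1 + cost c\<^sub>2) (\<lambda>s'. s' = result c\<^sub>2 (result c\<^sub>1 s))"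
    by (rule runs_Seq[where P = "\<lambda>s'. s' = result c\<^sub>1 s"]) (use Seq in auto)
  then show ?case by simp
next
  case (Cond b c\<^sub>1 c\<^sub>2)
  then obtain t\<^sub>1 t\<^sub>2 where
    "exec c\<^sub>1 s t\<^sub>1 (result c\<^sub>1 s)" "t\<^sub>1 \<le> cost c\<^sub>1"
    "exec c\<^sub>2 s t\<^sub>2 (result c\<^sub>2 s)" "t\<^sub>2 \<le> cost c\<^sub>2"
    unfolding runs_def straight.simps by metis
  then show ?case
    by (cases "bval b s") (auto intro: runsI[OF exec.CondTrue] runsI[OF exec.CondFalse])
next
  case Skip
  show ?case by (rule runsI[OF exec.Skip]) auto
next
  case (Assign x a)
  show ?case by (rule runsI[OF exec.Assign]) (auto simp: upd_def)
next
  case (Store a e)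
  show ?case by (rule runsI[OF exec.Store]) auto
qed simp

lemma runs_straight:
  assumes "straight c" "cost c \<le> T" "Q (result c s)"
  shows "runs c s T Q"
  by (rule runs_weaken[OF runs_straight_result[OF assms(1)]]) (use assms in auto)

lemma runs_straight_Seq:
  assumes "straight c\<^sub>1" "cost c\<^sub>1 \<le> T\<^sub>1" "runs c\<^sub>2 (result c\<^sub>1 s) T\<^sub>2 Q"
  shows "runs (c\<^sub>1 ;; c\<^sub>2) s (T\<^sub>1 + T\<^sub>2) Q"
  by (rule runs_Seq[where P = "\<lambda>s'. s' = result c\<^sub>1 s"]) (use assms in \<open>auto intro: runs_straight\<close>)

text \<open>
  Sixteen arrays are interleaved above the input: entry \<open>i\<close> of array \<open>k\<close> is the cell
  \<open>b + 16 * i + k\<close>, where the variable \<open>b\<close> holds \<open>2 * n + 1\<close>. The address is computed by repeated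
  doubling, as the machine does not multiply.
\<close>

definition arr :: "nat \<Rightarrow> state \<Rightarrow> nat \<Rightarrow> nat" where
  "arr k s i = snd s (fst s ''b'' + 16 * i + k)"

definition put :: "nat \<Rightarrow> nat \<Rightarrow> nat \<Rightarrow> state \<Rightarrow> state" where
  "put k i v s = (fst s, (snd s)(fst s ''b'' + 16 * i + k := v))"

definition cell :: "nat \<Rightarrow> aexp \<Rightarrow> aexp" where
  "cell k a = (let a\<^sub>2 = Plus a a; a\<^sub>4 = Plus a\<^sub>2 a\<^sub>2; a\<^sub>8 = Plus a\<^sub>4 a\<^sub>4
    in Plus (Plus (V ''b'') (Plus a\<^sub>8 a\<^sub>8)) (N k))"

definition rd :: "nat \<Rightarrow> aexp \<Rightarrow> aexp" where
  "rd k a = Load (cell k a)"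

definition wr :: "nat \<Rightarrow> aexp \<Rightarrow> aexp \<Rightarrow> com" where
  "wr k a e = Store (cell k a) e"

definition assign_if :: "bexp \<Rightarrow> vname \<Rightarrow> aexp \<Rightarrow> com" where
  "assign_if b x a = Cond b (Assign x a) Skip"

lemma aval_cell [simp]: "aval (cell k a) s = fst s ''b'' + 16 * aval a s + k"
  by (simp add: cell_def Let_def)

lemma aval_rd [simp]: "aval (rd k a) s = arr k s (aval a s)"
  by (simp add: rd_def arr_def)

text \<open>The \<open>let\<close> shares terms in the logic only: the address expression contains
  16 copies of \<open>a\<close>, each evaluated anew.\<close>

lemma acost_cell [simp]: "acost (cell k a) = 16 * acost a + 19"
  by (simp add: cell_def Let_def)

lemma acost_rd [simp]: "acost (rd k a) = 16 * acost a + 20"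
  by (simp add: rd_def)

lemma wr_simps [simp]:
  "straight (wr k a e)" "cost (wr k a e) = 16 * acost a + acost e + 20"
  "result (wr k a e) s = put k (aval a s) (aval e s) s"
  by (simp_all add: wr_def put_def)

lemma assign_if_simps [simp]:
  "straight (assign_if b x a)" "cost (assign_if b x a) = 2 + bcost b + acost a"
  "result (assign_if b x a) s = upd x (if bval b s then aval a s else fst s x) s"
proof -
  have "0 < acost a" by (cases a) auto
  then show "cost (assign_if b x a) = 2 + bcost b + acost a" by (simp add: assign_if_def max_def)
qed (simp_all add: assign_if_def upd_def)

lemma fst_upd [simp]: "fst (upd x v s) y = (if y = x then v else fst s y)"
  by (simp add: upd_def)

lemma snd_upd [simp]: "snd (upd x v s) = snd s"
  by (simp add: upd_def)

lemma fst_put [simp]: "fst (put k i v s) = fst s"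
  by (simp add: put_def)

lemma snd_put [simp]: "a < fst s ''b'' \<Longrightarrow> snd (put k i v s) a = snd s a"
  by (simp add: put_def)

lemma arr_upd [simp]: "x \<noteq> ''b'' \<Longrightarrow> arr k (upd x v s) = arr k s"
  by (simp add: arr_def fun_eq_iff)

text \<open>The residue of the offset modulo 16 identifies the array, so the interleaved arrays
  never overlap.\<close>

lemma arr_put:
  assumes "k < 16" "k' < 16"
  shows "arr k (put k' i v s) = (if k = k' then (arr k s)(i := v) else arr k s)"
proof -
  have "16 * j + k = 16 * i + k' \<longleftrightarrow> j = i \<and> k = k'" for j
  proof
    assume eq: "16 * j + k = 16 * i + k'"
    have "k = k'" using arg_cong[OF eq, of "\<lambda>x. x mod 16"] assms by simp
    with eq show "j = i \<and> k = k'" by simp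
  qed simp
  then have "fst s ''b'' + 16 * j + k = fst s ''b'' + 16 * i + k' \<longleftrightarrow> j = i \<and> k = k'" for j
    by (simp only: add.assoc add_left_cancel)
  then show ?thesis by (simp add: arr_def put_def fun_eq_iff)
qed

section \<open>Memory layout and program\<close>

abbreviation (input) "VAL \<equiv> (2::nat)"
abbreviation (input) "POS \<equiv> (3::nat)"
abbreviation (input) "QQ \<equiv> (4::nat)"
abbreviation (input) "LEV \<equiv> (5::nat)"
abbreviation (input) "ROW \<equiv> (6::nat)"
abbreviation (input) "ELEM \<equiv> (7::nat)"
abbreviation (input) "SIZE \<equiv> (8::nat)"
abbreviation (input) "DIGIT \<equiv> (9::nat)"
abbreviation (input) "WEIGHT \<equiv> (10::nat)"
abbreviation (input) "COUNT \<equiv> (11::nat)"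

text \<open>
  \<open>QQ\<close> holds \<open>q = inv \<sigma>\<^sub>2 \<circ> \<sigma>\<^sub>1\<close>. Row \<open>p\<close> of the two-dimensional array \<open>ELEM\<close> lists the elements of
  level \<open>p\<close> and starts at \<open>ROW p = p * n\<close>. \<open>DIGIT\<close> is a mixed radix counter with digits bounded by
  \<open>SIZE\<close> and place values \<open>WEIGHT\<close>; its value \<open>t\<close> indexes \<open>COUNT\<close>.
\<close>

definition "read_body =
  wr VAL (V ''j'') (Load (V ''j'')) ;;
  wr POS (Load (Plus (V ''n'') (V ''j''))) (V ''j'') ;;
  wr ROW (V ''j'') (Plus (rd ROW (Minus (V ''j'') (N 1))) (V ''n'')) ;;
  Assign ''j'' (Plus (V ''j'') (N 1))"

definition "read_input =
  (Assign ''n'' (Load (N 0)) ;;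
   Assign ''b'' (Plus (Plus (V ''n'') (V ''n'')) (N 1)) ;;
   Assign ''j'' (N 1)) ;;
  While (Less (V ''j'') (Plus (V ''n'') (N 1))) read_body"

text \<open>One scan of the earlier positions does two things: \<open>l\<close> is the running
  maximum that becomes the level of \<open>i\<close>, and \<open>f\<close> records a violation of
  \<open>\<sigma>\<^sub>1 \<prec> \<sigma>\<^sub>2\<close>.\<close>

definition "level_body =
  assign_if (Conj (Less (rd QQ (V ''i'')) (rd QQ (V ''j''))) (Less (V ''l'') (Plus (rd LEV (V ''j'')) (N 1))))
    ''l'' (Plus (rd LEV (V ''j'')) (N 1)) ;;
  assign_if (Conj (Less (rd QQ (V ''i'')) (rd QQ (V ''j''))) (Less (rd VAL (V ''i'')) (rd VAL (V ''j''))))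
    ''f'' (N 1) ;;
  Assign ''j'' (Plus (V ''j'') (N 1))"

definition "chain_body =
  (wr QQ (V ''i'') (rd POS (rd VAL (V ''i''))) ;;
   Assign ''l'' (N 0) ;;
   Assign ''j'' (N 1)) ;;
  While (Less (V ''j'') (V ''i'')) level_body ;;
  (wr LEV (V ''i'') (V ''l'') ;;
   wr ELEM (Plus (rd ROW (V ''l'')) (rd SIZE (V ''l''))) (V ''i'') ;;
   wr SIZE (V ''l'') (Plus (rd SIZE (V ''l'')) (N 1)) ;;
   assign_if (Less (V ''m'') (Plus (V ''l'') (N 1))) ''m'' (Plus (V ''l'') (N 1)) ;;
   Assign ''i'' (Plus (V ''i'') (N 1)))"

definition "build_chains =
  (Assign ''f'' (N 0) ;; Assign ''m'' (N 0) ;; Assign ''i'' (N 1)) ;;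
  While (Less (V ''i'') (Plus (V ''n'') (N 1))) chain_body"

definition "multiply_body =
  Assign ''a'' (Plus (V ''a'') (V ''M'')) ;; Assign ''r'' (Plus (V ''r'') (N 1))"

text \<open>Starting \<open>a\<close> at \<open>M\<close> rather than 0 supplies the extra one in
  the base \<open>Suc (SIZE p)\<close>.\<close>

definition "weight_body =
  (wr WEIGHT (V ''p'') (V ''M'') ;; Assign ''a'' (V ''M'') ;; Assign ''r'' (N 0)) ;;
  While (Less (V ''r'') (rd SIZE (V ''p''))) multiply_body ;;
  (Assign ''M'' (V ''a'') ;; Assign ''p'' (Plus (V ''p'') (N 1)))"

definition "compute_weights =
  (Assign ''M'' (N 1) ;; Assign ''p'' (N 0)) ;;
  While (Less (V ''p'') (V ''m'')) weight_body"

text \<open>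
  If the digit is 0, the prefix is empty and the value read is junk; all uses are guarded by a test
  of the digit.
\<close>

definition top_elem :: "vname \<Rightarrow> aexp" where
  "top_elem p = rd ELEM (Plus (rd ROW (V p)) (Minus (rd DIGIT (V p)) (N 1)))"

definition "compare_body =
  Assign ''y'' (top_elem ''r'') ;;
  assign_if (Conj (Less (N 0) (rd DIGIT (V ''r'')))
      (Conj (Less (V ''x'') (V ''y'')) (Less (rd QQ (V ''x'')) (rd QQ (V ''y'')))))
    ''k'' (N 0) ;;
  Assign ''r'' (Plus (V ''r'') (N 1))"

text \<open>\<open>k\<close> is a flag for removability: it starts as the digit, so an empty prefix
  fails at once, and a larger top sets it to 0.\<close>

definition "add_body =
  (Assign ''k'' (rd DIGIT (V ''p'')) ;; Assign ''x'' (top_elem ''p'') ;; Assign ''r'' (N 0)) ;;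
  While (Less (V ''r'') (V ''m'')) compare_body ;;
  (assign_if (Less (N 0) (V ''k''))
     ''a'' (Plus (V ''a'') (rd COUNT (Minus (V ''t'') (rd WEIGHT (V ''p''))))) ;;
   Assign ''p'' (Plus (V ''p'') (N 1)))"

text \<open>The new digit \<open>v\<close> doubles as exit flag: 0 means that the digit wrapped, and
  only then does \<open>1 - v\<close> move \<open>p\<close> on to the next place.\<close>

definition "carry_body =
  Assign ''v'' (N 0) ;;
  assign_if (Less (rd DIGIT (V ''p'')) (rd SIZE (V ''p''))) ''v'' (Plus (rd DIGIT (V ''p'')) (N 1)) ;;
  wr DIGIT (V ''p'') (V ''v'') ;;
  Assign ''p'' (Plus (V ''p'') (Minus (N 1) (V ''v'')))"

definition "count_body =
  (Assign ''a'' (Minus (N 1) (V ''t'')) ;; Assign ''p'' (N 0)) ;;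
  While (Less (V ''p'') (V ''m'')) add_body ;;
  (wr COUNT (V ''t'') (V ''a'') ;; Assign ''p'' (N 0) ;; Assign ''v'' (N 0)) ;;
  While (Conj (Less (V ''p'') (V ''m'')) (Less (V ''v'') (N 1))) carry_body ;;
  Assign ''t'' (Plus (V ''t'') (N 1))"

definition "count_extensions =
  Assign ''t'' (N 0) ;;
  While (Less (V ''t'') (V ''M'')) count_body"

definition "write_output =
  Cond (Less (V ''f'') (N 1)) (Store (N 0) (rd COUNT (Minus (V ''M'') (N 1)))) (Store (N 0) (N 0))"

definition "interval_program =
  read_input ;; build_chains ;; compute_weights ;; count_extensions ;; write_output"

section \<open>Correctness and running time\<close>

locale input_permutations =
  fixes n :: nat and \<sigma>\<^sub>1 \<sigma>\<^sub>2 :: "nat \<Rightarrow> nat"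
  assumes n_pos: "1 \<le> n" and perm1: "\<sigma>\<^sub>1 permutes {1..n}" and perm2: "\<sigma>\<^sub>2 permutes {1..n}"
begin

section \<open>Reading the permutations\<close>

definition q :: "nat \<Rightarrow> nat" where "q = inv \<sigma>\<^sub>2 \<circ> \<sigma>\<^sub>1"

abbreviation "m \<equiv> levels q n"
abbreviation "sz p \<equiv> length (chain q n p)"

definition scanned :: "nat \<Rightarrow> state \<Rightarrow> bool" where
  "scanned j s \<longleftrightarrow> fst s ''n'' = n \<and> fst s ''b'' = 2 * n + 1 \<and>
    (\<forall>i\<in>{1..<j}. arr VAL s i = \<sigma>\<^sub>1 i \<and> arr POS s (\<sigma>\<^sub>2 i) = i) \<and> (\<forall>i<j. arr ROW s i = i * n) \<and>
    (\<forall>i. arr DIGIT s i = 0)"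

lemma perm2_ne: "i \<in> {1..n} \<Longrightarrow> j \<in> {1..n} \<Longrightarrow> i \<noteq> j \<Longrightarrow> \<sigma>\<^sub>2 i \<noteq> \<sigma>\<^sub>2 j"
  using permutes_inj[OF perm2] by (auto simp: inj_eq)

text \<open>Here and below the numerals in the time bounds are round estimates from above of
  \<open>cost\<close>, left in the shape that \<open>runs_Seq\<close> and \<open>runs_While\<close>
  produce; 100 covers a loop test.\<close>

lemma runs_read_input:
  "runs read_input (input_state n \<sigma>\<^sub>1 \<sigma>\<^sub>2) (100 + (n * (2000 + 100) + 100))
    (\<lambda>s. scanned (Suc n) s \<and> (\<forall>p. arr SIZE s p = 0))"
  unfolding read_input_def
proof (rule runs_straight_Seq, goal_cases)
  case 3
  let ?I = "\<lambda>s. scanned (fst s ''j'') s \<and> (\<forall>p. arr SIZE s p = 0) \<and> fst s ''j'' \<in> {1..Suc n} \<and>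
    (\<forall>i\<in>{1..n}. snd s i = \<sigma>\<^sub>1 i \<and> snd s (n + i) = \<sigma>\<^sub>2 i)"
  show ?case
  proof (rule runs_While[where I = ?I and \<mu> = "\<lambda>s. Suc n - fst s ''j''"], goal_cases)
    case 1
    show ?case
      using n_pos by (simp add: scanned_def input_state_def upd_def arr_def)
  next
    case (2 s)
    show ?case
    proof (rule runs_straight, goal_cases)
      case 3
      define j where "j = fst s ''j''"
      have j: "j \<in> {1..n}" using 2 by (auto simp: j_def scanned_def)
      have I: "scanned j s" "\<forall>p. arr SIZE s p = 0" "\<forall>i\<in>{1..n}. snd s i = \<sigma>\<^sub>1 i \<and> snd s (n + i) = \<sigma>\<^sub>2 i"
        using 2 by (auto simp: j_def)
      have bn: "fst s ''b'' = 2 * n + 1" "fst s ''n'' = n" using I by (auto simp: scanned_def)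
      have res: "result read_body s = upd ''j'' (Suc j) (put ROW j (arr ROW s (j - 1) + n) (put POS (\<sigma>\<^sub>2 j) j (put VAL j (\<sigma>\<^sub>1 j) s)))"
        using j I bn by (simp add: read_body_def j_def[symmetric] arr_put)
      have "arr ROW s (j - 1) + n = j * n"
        using I j by (cases j) (auto simp: scanned_def)
      then show ?case
        using I j perm2_ne bn unfolding res scanned_def
        by (auto simp: scanned_def arr_put j_def[symmetric])
    qed (simp_all add: read_body_def)
  next
    case (3 s)
    then have "fst s ''j'' = Suc n" by (auto simp: scanned_def)
    with 3 show ?case by simp
  next
    case 4
    show ?case by simp
  next
    case 5
    show ?case by simp
  qed
next
  case 1
  show ?case by simp
next
  case 2
  show ?case by simp
qed

lemma scanned_upd [simp]: "x \<noteq> ''n'' \<Longrightarrow> x \<noteq> ''b'' \<Longrightarrow> scanned j (upd x v s) = scanned j s"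
  by (simp add: scanned_def)

lemma scanned_put [simp]:
  "k < 16 \<Longrightarrow> k \<notin> {VAL, POS, ROW, DIGIT} \<Longrightarrow> scanned j (put k i v s) = scanned j s"
  by (simp add: scanned_def arr_put)

text \<open>
  A pair of positions \<open>y < x\<close> whose values are inverted in \<open>\<sigma>\<^sub>1\<close> but not in \<open>\<sigma>\<^sub>2\<close>.
\<close>

definition clash :: "nat \<Rightarrow> nat \<Rightarrow> bool" where
  "clash x y \<longleftrightarrow> q x < q y \<and> \<sigma>\<^sub>1 x < \<sigma>\<^sub>1 y"

section \<open>Levels, chains and the test of the weak order\<close>

definition partial_lev :: "nat \<Rightarrow> nat \<Rightarrow> nat" where
  "partial_lev i j = Max (insert 0 ((\<lambda>y. Suc (lev q y)) ` {y \<in> {1..<j}. q i < q y}))"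

lemma partial_lev_1 [simp]: "partial_lev i (Suc 0) = 0"
  by (simp add: partial_lev_def)

lemma partial_lev_self: "partial_lev i i = lev q i"
  by (simp add: partial_lev_def lev.simps[of q i])

lemma partial_lev_Suc:
  assumes "1 \<le> j"
  shows "partial_lev i (Suc j) = (if q i < q j \<and> partial_lev i j < Suc (lev q j) then Suc (lev q j) else partial_lev i j)"
proof -
  define A where "A = (\<lambda>y. Suc (lev q y)) ` {y \<in> {1..<j}. q i < q y}"
  have "{y \<in> {1..<Suc j}. q i < q y} =
      (if q i < q j then insert j {y \<in> {1..<j}. q i < q y} else {y \<in> {1..<j}. q i < q y})"
    using assms by (auto simp: less_Suc_eq)
  then have "partial_lev i (Suc j) = Max (insert 0 (if q i < q j then insert (Suc (lev q j)) A else A))"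
    unfolding partial_lev_def A_def by (auto simp only: image_insert split: if_split)
  moreover have "partial_lev i j = Max (insert 0 A)"
    by (simp only: partial_lev_def A_def)
  moreover have "Max (insert 0 (insert x A)) = max x (Max (insert 0 A))" for x
    by (subst insert_commute, subst Max_insert) (simp_all add: A_def)
  ultimately show ?thesis by (simp only: max_def not_less split: if_split) auto
qed

definition chains_upto :: "nat \<Rightarrow> state \<Rightarrow> bool" where
  "chains_upto i s \<longleftrightarrow> scanned (Suc n) s \<and> fst s ''m'' = levels q i \<and>
    (\<forall>x\<in>{1..i}. arr QQ s x = q x \<and> arr LEV s x = lev q x) \<and>
    (\<forall>p. arr SIZE s p = length (chain q i p)) \<and>
    (\<forall>p<n. \<forall>r<length (chain q i p). arr ELEM s (p * n + r) = chain q i p ! r)"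

text \<open>Progress of the double scan: the rows before \<open>i\<close> are done, row
  \<open>i\<close> up to \<open>j\<close>. Reaching \<open>j = i\<close> is the same as starting row
  \<open>Suc i\<close> at 1.\<close>

definition clash_flag :: "nat \<Rightarrow> nat \<Rightarrow> state \<Rightarrow> bool" where
  "clash_flag i j s \<longleftrightarrow> (fst s ''f'' = 0 \<longleftrightarrow>
    (\<forall>x\<in>{1..<i}. \<forall>y\<in>{1..<x}. \<not> clash x y) \<and> (\<forall>y\<in>{1..<j}. \<not> clash i y))"

lemma chains_upto_upd [simp]:
  "x \<notin> {''n'', ''b'', ''m''} \<Longrightarrow> chains_upto i (upd x v s) = chains_upto i s"
  by (auto simp: chains_upto_def)

lemma q_eq: "i \<in> {1..n} \<Longrightarrow> scanned (Suc n) s \<Longrightarrow> arr POS s (arr VAL s i) = q i"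
proof -
  assume i: "i \<in> {1..n}" and s: "scanned (Suc n) s"
  have "\<sigma>\<^sub>2 (q i) = \<sigma>\<^sub>1 i" by (simp add: q_def permutes_inverses(1)[OF perm2])
  moreover have "q i \<in> {1..n}"
    using i permutes_in_image[OF permutes_inv[OF perm2]] permutes_in_image[OF perm1] by (simp add: q_def)
  ultimately show ?thesis using s i unfolding scanned_def by (metis atLeastLessThanSuc_atLeastAtMost)
qed

lemma runs_level_loop:
  assumes "chains_upto (i - 1) s" "clash_flag i 1 s" "fst s ''i'' = i" "i \<in> {1..n}" "arr QQ s i = q i"
    "fst s ''j'' = 1" "fst s ''l'' = 0"
  shows "runs (While (Less (V ''j'') (V ''i'')) level_body) s (n * (1000 + 100) + 100)
    (\<lambda>s. chains_upto (i - 1) s \<and> clash_flag i i s \<and> fst s ''i'' = i \<and> arr QQ s i = q i \<and>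
      fst s ''l'' = lev q i)"
proof (rule runs_While[where \<mu> = "\<lambda>s. i - fst s ''j''" and
    I = "\<lambda>s. chains_upto (i - 1) s \<and> clash_flag i (fst s ''j'') s \<and> fst s ''i'' = i \<and> arr QQ s i = q i \<and>
      fst s ''j'' \<in> {1..i} \<and> fst s ''l'' = partial_lev i (fst s ''j'')"], goal_cases)
  case 1
  then show ?case using assms by simp
next
  case (2 s)
  show ?case
  proof (rule runs_straight, goal_cases)
    case 3
    define j where "j = fst s ''j''"
    have j: "1 \<le> j" "j < i" "j \<in> {1..i - 1}" using 2 by (auto simp: j_def)
    have I: "chains_upto (i - 1) s" "clash_flag i j s" "fst s ''i'' = i" "arr QQ s i = q i"
      "fst s ''l'' = partial_lev i j"
      using 2 by (auto simp: j_def)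
    have vals: "arr QQ s j = q j" "arr LEV s j = lev q j" "arr VAL s j = \<sigma>\<^sub>1 j" "arr VAL s i = \<sigma>\<^sub>1 i"
      using I(1) j assms(4) by (auto simp: chains_upto_def scanned_def)
    have res: "result level_body s = upd ''j'' (Suc j) (upd ''f'' (if clash i j then 1 else fst s ''f'')
        (upd ''l'' (partial_lev i (Suc j)) s))"
      using j(1) I vals by (simp add: level_body_def j_def[symmetric] partial_lev_Suc clash_def)
    have "clash_flag i (Suc j) (result level_body s)"
      using I(2) j(1) unfolding res by (auto simp: clash_flag_def less_Suc_eq)
    then show ?case
      using I j unfolding res by (simp add: j_def[symmetric])
  qed (simp_all add: level_body_def)
next
  case (3 s)
  then have "fst s ''j'' = i" by auto
  with 3 show ?case by (simp add: partial_lev_self)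
next
  case 4
  then show ?case using assms by auto
qed simp

text \<open>The new element goes to offset \<open>arr SIZE s l\<close> of row \<open>l\<close>.
  Before it is appended a row holds fewer than \<open>n\<close> elements, so division by
  \<open>n\<close> recovers row and offset, and no other entry is overwritten.\<close>

lemma chains_upto_step:
  assumes "chains_upto (i - 1) s" "i \<in> {1..n}" "arr QQ s i = q i" "l = lev q i"
  shows "chains_upto i (upd ''i'' (Suc i) (upd ''m'' (if fst s ''m'' < Suc l then Suc l else fst s ''m'')
    (put SIZE l (Suc (arr SIZE s l)) (put ELEM (l * n + arr SIZE s l) i (put LEV i l s)))))"
proof -
  obtain i' where i': "i = Suc i'" using assms(2) by (cases i) auto
  have "l < n" using lev_lt[of i q] assms(2,4) by simp
  have size: "arr SIZE s p = length (chain q i' p)" for p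
    using assms(1) i' by (simp add: chains_upto_def)
  have lt: "length (chain q i' p) < n" for p
    using length_chain[of q i' p] assms(2) i' by simp
  have cell: "p * n + r = l * n + length (chain q i' l) \<longleftrightarrow> p = l \<and> r = length (chain q i' l)"
    if "r < n" for p r
  proof
    assume eq: "p * n + r = l * n + length (chain q i' l)"
    show "p = l \<and> r = length (chain q i' l)"
      using arg_cong[OF eq, of "\<lambda>x. x div n"] arg_cong[OF eq, of "\<lambda>x. x mod n"] that lt[of l] by simp
  qed simp
  have elem: "((arr ELEM s)(l * n + length (chain q i' l) := i)) (p * n + r) = chain q i p ! r"
    if "p < n" "r < length (chain q i p)" for p r
  proof -
    have "length (chain q i p) \<le> n" using length_chain[of q i p] assms(2) by simp
    then have "r < n" using that by simp
    then show ?thesis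
      using that assms(1,4) cell[of r p] unfolding i' chain_Suc
      by (auto simp: chains_upto_def nth_append split: if_splits)
  qed
  have "arr QQ s x = q x \<and> ((arr LEV s)(i := l)) x = lev q x" if "x \<in> {1..i}" for x
    using that assms i' by (cases "x = i") (auto simp: chains_upto_def)
  then show ?thesis
    using assms(1,4) elem unfolding chains_upto_def
    by (simp add: arr_put size i' levels_Suc chain_Suc max_def)
qed

lemma runs_build_chains:
  assumes "scanned (Suc n) s" "\<forall>p. arr SIZE s p = 0"
  shows "runs build_chains s (100 + (n * ((2000 + ((n * (1000 + 100) + 100) + 4000)) + 100) + 100))
    (\<lambda>s. chains_upto n s \<and> clash_flag (Suc n) 1 s)"
  unfolding build_chains_def
proof (rule runs_straight_Seq, goal_cases)
  case 3
  show ?case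
  proof (rule runs_While[where \<mu> = "\<lambda>s. Suc n - fst s ''i''" and
      I = "\<lambda>s. chains_upto (fst s ''i'' - 1) s \<and> clash_flag (fst s ''i'') 1 s \<and> fst s ''i'' \<in> {1..Suc n}"],
      goal_cases)
    case 1
    show ?case using assms by (simp add: chains_upto_def clash_flag_def)
  next
    case (2 s)
    define i where "i = fst s ''i''"
    have i: "i \<in> {1..n}" using 2 by (auto simp: i_def chains_upto_def scanned_def)
    have I: "chains_upto (i - 1) s" "clash_flag i 1 s" using 2 by (auto simp: i_def)
    have i'[simp]: "fst s ''i'' = i" by (simp add: i_def)
    have sc: "scanned (Suc n) s" using I by (simp add: chains_upto_def)
    show ?case unfolding chain_body_def i'
    proof (rule runs_straight_Seq[OF _ _ runs_Seq[OF runs_level_loop[of i]]], goal_cases)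
      case 3
      have "chains_upto (i - 1) (put QQ i (q i) s)"
        using I(1) i by (auto simp: chains_upto_def arr_put)
      then show ?case by (simp add: q_eq[OF i sc])
    next
      case 4
      show ?case using I(2) by (simp add: clash_flag_def)
    next
      case 7
      show ?case by (simp add: q_eq[OF i sc] arr_put)
    next
      case (10 s')
      then have s': "chains_upto (i - 1) s'" "clash_flag i i s'" "fst s' ''i'' = i" "arr QQ s' i = q i"
        "fst s' ''l'' = lev q i"
        by auto
      have "lev q i \<le> n" using lev_lt[of i q] i by simp
      then have row: "arr ROW s' (lev q i) = lev q i * n"
        using s'(1) by (simp add: chains_upto_def scanned_def)
      show ?case
      proof (rule runs_straight, goal_cases)
        case 3
        have flag: "clash_flag (Suc i) 1 s'"
          using s'(2) i by (auto simp: clash_flag_def less_Suc_eq)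
        show ?case
          using chains_upto_step[OF s'(1) i s'(4) refl] flag i s'(3,5)
          by (simp add: arr_put row clash_flag_def split: if_splits)
      qed simp_all
    qed (use i in simp_all)
  next
    case (3 s)
    then have "fst s ''i'' = Suc n" by (auto simp: chains_upto_def scanned_def)
    with 3 show ?case by simp
  next
    case 4
    show ?case by simp
  next
    case 5
    show ?case by simp
  qed
qed simp_all

lemma weak_le_iff_no_clash:
  "weak_le n \<sigma>\<^sub>1 \<sigma>\<^sub>2 \<longleftrightarrow> (\<forall>x\<in>{1..<Suc n}. \<forall>y\<in>{1..<x}. \<not> clash x y)"
proof
  assume le: "weak_le n \<sigma>\<^sub>1 \<sigma>\<^sub>2"
  show "\<forall>x\<in>{1..<Suc n}. \<forall>y\<in>{1..<x}. \<not> clash x y"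
  proof (intro ballI notI)
    fix x y assume "y \<in> {1..<x}" and c: "clash x y"
    then have "q y < q x"
      using weak_le_imp_inversions[OF le, of "\<sigma>\<^sub>1 x" "\<sigma>\<^sub>1 y"] permutes_inverses(2)[OF perm1]
      by (simp add: clash_def q_def)
    with c show False by (simp add: clash_def)
  qed
next
  assume nc: "\<forall>x\<in>{1..<Suc n}. \<forall>y\<in>{1..<x}. \<not> clash x y"
  show "weak_le n \<sigma>\<^sub>1 \<sigma>\<^sub>2"
  proof (rule inversions_imp_weak_le[OF perm1 perm2])
    fix a b assume ab: "a < b" "inv \<sigma>\<^sub>1 b < inv \<sigma>\<^sub>1 a"
    have img: "inv \<sigma>\<^sub>1 x \<in> {1..n} \<longleftrightarrow> x \<in> {1..n}" "x \<notin> {1..n} \<Longrightarrow> inv \<sigma>\<^sub>1 x = x" for x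
      using permutes_in_image[OF permutes_inv[OF perm1]] permutes_not_in[OF permutes_inv[OF perm1]] by auto
    have "a \<in> {1..n}" "b \<in> {1..n}"
      using ab img[of a] img[of b] by (cases "a \<in> {1..n}"; cases "b \<in> {1..n}"; auto)+
    then have "inv \<sigma>\<^sub>1 a \<in> {1..<Suc n}" "inv \<sigma>\<^sub>1 b \<in> {1..<inv \<sigma>\<^sub>1 a}"
      using img[of a] img[of b] ab by auto
    then have "\<not> clash (inv \<sigma>\<^sub>1 a) (inv \<sigma>\<^sub>1 b)" using nc by blast
    then have "\<not> inv \<sigma>\<^sub>2 a < inv \<sigma>\<^sub>2 b"
      using ab by (simp add: clash_def q_def permutes_inverses(1)[OF perm1])
    moreover have "inv \<sigma>\<^sub>2 a \<noteq> inv \<sigma>\<^sub>2 b"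
      using ab permutes_inj[OF permutes_inv[OF perm2]] by (simp add: inj_eq)
    ultimately show "inv \<sigma>\<^sub>2 b < inv \<sigma>\<^sub>2 a" by simp
  qed
qed

lemma q_permutes: "q permutes {1..n}"
  unfolding q_def by (intro permutes_compose[OF perm1] permutes_inv[OF perm2])

lemma levels_le: "m \<le> n"
proof (cases m)
  case (Suc p)
  then obtain i where "i \<in> {1..n}" "lev q i = p" using levels_obtain[of p q n] by auto
  then show ?thesis using Suc lev_lt[of i q] by simp
qed simp

text \<open>The interface to the counting phase: the flag \<open>f\<close> is now read as the truth
  of \<open>\<sigma>\<^sub>1 \<prec> \<sigma>\<^sub>2\<close>.\<close>

definition ready :: "state \<Rightarrow> bool" where
  "ready s \<longleftrightarrow> fst s ''m'' = m \<and> (fst s ''f'' = 0 \<longleftrightarrow> weak_le n \<sigma>\<^sub>1 \<sigma>\<^sub>2) \<and>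
    (\<forall>x\<in>{1..n}. arr QQ s x = q x) \<and> (\<forall>p<m. arr ROW s p = p * n) \<and> (\<forall>p. arr SIZE s p = sz p) \<and>
    (\<forall>p<m. \<forall>r<sz p. arr ELEM s (p * n + r) = chain q n p ! r)"

lemma ready_upd [simp]: "x \<notin> {''b'', ''m'', ''f''} \<Longrightarrow> ready (upd x v s) = ready s"
  by (auto simp: ready_def)

lemma ready_put [simp]: "k < 16 \<Longrightarrow> k \<notin> {QQ, ROW, SIZE, ELEM} \<Longrightarrow> ready (put k i v s) = ready s"
  by (simp add: ready_def arr_put)

lemma chains_upto_ready:
  assumes "chains_upto n s" "clash_flag (Suc n) 1 s"
  shows "ready s \<and> (\<forall>p. arr DIGIT s p = 0)"
  using assms levels_le weak_le_iff_no_clash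
  by (simp add: ready_def chains_upto_def scanned_def clash_flag_def)

lemma runs_compute_weights:
  assumes "ready s" "\<forall>p. arr DIGIT s p = 0"
  shows "runs compute_weights s (100 + (m * ((1000 + ((n * (100 + 100) + 100) + 100)) + 100) + 100))
    (\<lambda>s. ready s \<and> (\<forall>p. arr DIGIT s p = 0) \<and> (\<forall>p<m. arr WEIGHT s p = radix sz p) \<and> fst s ''M'' = radix sz m)"
  unfolding compute_weights_def
proof (rule runs_straight_Seq, goal_cases)
  case 3
  let ?J = "\<lambda>p s. ready s \<and> (\<forall>p. arr DIGIT s p = 0) \<and> (\<forall>j<p. arr WEIGHT s j = radix sz j)"
  show ?case
  proof (rule runs_While[where \<mu> = "\<lambda>s. m - fst s ''p''" and
      I = "\<lambda>s. ?J (fst s ''p'') s \<and> fst s ''M'' = radix sz (fst s ''p'') \<and> fst s ''p'' \<le> m"], goal_cases)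
    case 1
    show ?case using assms by simp
  next
    case (2 s)
    define p where "p = fst s ''p''"
    have p: "p < m" using 2 by (simp add: p_def ready_def)
    have I: "?J p s" "fst s ''M'' = radix sz p" "fst s ''p'' = p" using 2 by (simp_all add: p_def)
    show ?case unfolding weight_body_def I(3)
    proof (rule runs_straight_Seq[OF _ _ runs_Seq[OF
        runs_While[where Q = "\<lambda>s. ?J (Suc p) s \<and> fst s ''p'' = p \<and> fst s ''a'' = radix sz (Suc p)" and
          \<mu> = "\<lambda>s. sz p - fst s ''r''" and
          I = "\<lambda>s. ?J (Suc p) s \<and> fst s ''p'' = p \<and> fst s ''M'' = radix sz p \<and>
            fst s ''a'' = radix sz p * Suc (fst s ''r'') \<and> fst s ''r'' \<le> sz p"]]], goal_cases)
      case 3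
      show ?case using I by (simp add: arr_put less_Suc_eq)
    next
      case (4 s')
      then have "fst s' ''r'' < sz p" by (simp add: ready_def)
      with 4 show ?case by (intro runs_straight) (auto simp: multiply_body_def)
    next
      case (5 s')
      then have "fst s' ''r'' = sz p" by (simp add: ready_def)
      with 5 show ?case by (simp add: radix_Suc)
    next
      case 6
      show ?case using length_chain[of q n p] by simp
    next
      case (8 s')
      then show ?case using p by (intro runs_straight) auto
    qed simp_all
  next
    case (3 s)
    then have "fst s ''p'' = m" by (simp add: ready_def)
    with 3 show ?case by simp
  next
    case 4
    show ?case by simp
  next
    case 5
    show ?case by simp
  qed
qed simp_all

section \<open>The table of counts\<close>

definition valid :: "(nat \<Rightarrow> nat) \<Rightarrow> bool" where
  "valid d \<longleftrightarrow> (\<forall>p<m. d p \<le> sz p)"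

definition ext_count :: "(nat \<Rightarrow> nat) \<Rightarrow> nat" where
  "ext_count d = card (lin_exts (common_order q) (prefixes q n d))"

text \<open>The filled part of the table is described by digit tuples rather than indices, so an
  index never has to be decoded.\<close>

definition counted :: "nat \<Rightarrow> state \<Rightarrow> bool" where
  "counted t s \<longleftrightarrow> ready s \<and> (\<forall>p<m. arr WEIGHT s p = radix sz p) \<and> fst s ''M'' = radix sz m \<and>
    (\<forall>d. valid d \<longrightarrow> mixed sz m d < t \<longrightarrow> arr COUNT s (mixed sz m d) = ext_count d)"

lemma counted_upd [simp]:
  "x \<notin> {''b'', ''m'', ''f'', ''M''} \<Longrightarrow> counted t (upd x v s) = counted t s"
  by (auto simp: counted_def)

lemma counted_put_digit [simp]: "counted t (put DIGIT i v s) = counted t s"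
  by (simp add: counted_def arr_put)

lemma inj_q: "inj q"
  using permutes_inj[OF q_permutes] .

lemma ext_count_cong: "(\<And>p. p < m \<Longrightarrow> d p = d' p) \<Longrightarrow> ext_count d = ext_count d'"
  by (simp add: ext_count_def prefixes_def)

lemma ext_count_rec:
  assumes "valid d"
  shows "ext_count d = (if mixed sz m d = 0 then 1 else 0) +
    (\<Sum>p | p < m \<and> removable q n d p. ext_count (d(p := d p - 1)))"
  using card_lin_exts_prefixes[OF inj_q, of n d] assms by (simp add: valid_def ext_count_def mixed_eq_0_iff)

lemma top_value:
  assumes "ready s" "valid d" "p < m" "0 < d p"
  shows "arr ELEM s (arr ROW s p + (d p - 1)) = top_of q n d p" "top_of q n d p \<in> {1..n}"
proof -
  have "d p \<le> sz p" using assms(2,3) by (simp add: valid_def)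
  then have "d p - 1 < sz p" using assms(4) by linarith
  then show "arr ELEM s (arr ROW s p + (d p - 1)) = top_of q n d p" "top_of q n d p \<in> {1..n}"
    using assms(1,3) nth_mem[of "d p - 1" "chain q n p"] by (auto simp: ready_def set_chain)
qed

lemma runs_compare_loop:
  assumes "valid d" "p < m"
    and "counted t s" "arr DIGIT s = d" "fst s ''t'' = t" "fst s ''p'' = p" "fst s ''a'' = A"
    and "fst s ''r'' = 0" "fst s ''k'' = d p" "0 < d p \<Longrightarrow> fst s ''x'' = top_of q n d p"
  shows "runs (While (Less (V ''r'') (V ''m'')) compare_body) s (m * (5000 + 100) + 100)
    (\<lambda>s. counted t s \<and> arr DIGIT s = d \<and> fst s ''t'' = t \<and> fst s ''p'' = p \<and> fst s ''a'' = A \<and>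
      (0 < fst s ''k'' \<longleftrightarrow> removable q n d p))"
proof (rule runs_While[where \<mu> = "\<lambda>s. m - fst s ''r''" and
    I = "\<lambda>s. counted t s \<and> arr DIGIT s = d \<and> fst s ''t'' = t \<and> fst s ''p'' = p \<and> fst s ''a'' = A \<and>
      (0 < d p \<longrightarrow> fst s ''x'' = top_of q n d p) \<and> fst s ''r'' \<le> m \<and>
      (0 < fst s ''k'' \<longleftrightarrow> 0 < d p \<and>
        (\<forall>r<fst s ''r''. 0 < d r \<longrightarrow> \<not> common_order q (top_of q n d p) (top_of q n d r)))"], goal_cases)
  case 1
  then show ?case using assms by simp
next
  case (2 s)
  define r where "r = fst s ''r''"
  have [simp]: "fst s ''r'' = r" by (simp add: r_def)
  have I: "counted t s" "arr DIGIT s = d" "fst s ''t'' = t" "fst s ''p'' = p" "fst s ''a'' = A"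
    "0 < d p \<Longrightarrow> fst s ''x'' = top_of q n d p"
    "0 < fst s ''k'' \<longleftrightarrow> 0 < d p \<and>
        (\<forall>j<r. 0 < d j \<longrightarrow> \<not> common_order q (top_of q n d p) (top_of q n d j))"
    using 2 by auto
  have rd: "ready s" using I(1) by (simp add: counted_def)
  have r: "r < m" using 2 rd by (simp add: ready_def)
  define y where "y = arr ELEM s (arr ROW s r + (d r - 1))"
  define k where "k = (if 0 < d r \<and> fst s ''x'' < y \<and> arr QQ s (fst s ''x'') < arr QQ s y then 0 else fst s ''k'')"
  have res: "result compare_body s = upd ''r'' (Suc r) (upd ''k'' k (upd ''y'' y s))"
    by (cases "d r") (simp_all add: compare_body_def top_elem_def I(2) y_def k_def)
  have k: "0 < k \<longleftrightarrow> 0 < d p \<and>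
      (\<forall>j<Suc r. 0 < d j \<longrightarrow> \<not> common_order q (top_of q n d p) (top_of q n d j))"
  proof (cases "0 < d p \<and> 0 < d r")
    case True
    have "y = top_of q n d r" "fst s ''x'' = top_of q n d p"
      using top_value(1)[OF rd assms(1) r] True I(6) by (simp_all add: y_def)
    moreover have "arr QQ s (top_of q n d r) = q (top_of q n d r)" "arr QQ s (top_of q n d p) = q (top_of q n d p)"
      using top_value(2)[OF rd assms(1)] True r assms(2) rd unfolding ready_def by blast+
    ultimately have "k = (if common_order q (top_of q n d p) (top_of q n d r) then 0 else fst s ''k'')"
      using True by (simp add: k_def common_order_def)
    then show ?thesis using I(7) True by (auto simp: less_Suc_eq)
  next
    \<comment> \<open>If \<open>d r = 0\<close> the guard keeps \<open>k\<close>; if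
      \<open>d p = 0\<close> then \<open>k\<close> is 0 already. Junk tops have no effect in either
      case.\<close>
    case False
    then show ?thesis using I(7) by (auto simp: less_Suc_eq k_def)
  qed
  show ?case
  proof (rule runs_straight, goal_cases)
    case 3
    show ?case unfolding res using I(1-6) r k by simp
  qed (simp_all add: compare_body_def top_elem_def)
next
  case (3 s)
  then have "fst s ''r'' = m" by (auto simp: counted_def ready_def)
  with 3 show ?case by (simp add: removable_def)
next
  case 4
  show ?case by simp
next
  case 5
  show ?case by simp
qed

lemma runs_add_loop:
  assumes "valid d" "mixed sz m d = t"
    and "counted t s" "arr DIGIT s = d" "fst s ''t'' = t" "fst s ''p'' = 0" "fst s ''a'' = 1 - t"
  shows "runs (While (Less (V ''p'') (V ''m'')) add_body) s (m * ((5000 + ((m * (5000 + 100) + 100) + 5000)) + 100) + 100)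
    (\<lambda>s. counted t s \<and> arr DIGIT s = d \<and> fst s ''t'' = t \<and> fst s ''a'' = ext_count d)"
proof (rule runs_While[where \<mu> = "\<lambda>s. m - fst s ''p''" and
    I = "\<lambda>s. counted t s \<and> arr DIGIT s = d \<and> fst s ''t'' = t \<and> fst s ''p'' \<le> m \<and>
      fst s ''a'' = (1 - t) + (\<Sum>j | j < fst s ''p'' \<and> removable q n d j. ext_count (d(j := d j - 1)))"], goal_cases)
  case 1
  then show ?case using assms by simp
next
  case (2 s)
  define p where "p = fst s ''p''"
  have [simp]: "fst s ''p'' = p" by (simp add: p_def)
  define A where "A = (1 - t) + (\<Sum>j | j < p \<and> removable q n d j. ext_count (d(j := d j - 1)))"
  have I: "counted t s" "arr DIGIT s = d" "fst s ''t'' = t" "fst s ''a'' = A"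
    using 2 by (auto simp: A_def)
  have rd: "ready s" using I(1) by (simp add: counted_def)
  have p: "p < m" using 2 rd by (simp add: ready_def)
  show ?case unfolding add_body_def
  proof (rule runs_straight_Seq[OF _ _ runs_Seq[OF runs_compare_loop[OF assms(1) p, of t _ A]]], goal_cases)
    case 10
    then show ?case
      using top_value(1)[OF rd assms(1) p] by (simp add: top_elem_def I(2))
  next
    case (11 s')
    then have s': "counted t s'" "arr DIGIT s' = d" "fst s' ''t'' = t" "fst s' ''p'' = p" "fst s' ''a'' = A"
      "0 < fst s' ''k'' \<longleftrightarrow> removable q n d p"
      by auto
    have A: "(if 0 < fst s' ''k'' then A + arr COUNT s' (t - arr WEIGHT s' p) else A) =
        (1 - t) + (\<Sum>j | j < Suc p \<and> removable q n d j. ext_count (d(j := d j - 1)))"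
    proof (cases "removable q n d p")
      case True
      then have dp: "0 < d p" by (simp add: removable_def)
      let ?d = "d(p := d p - 1)"
      have "valid ?d" using assms(1) by (auto simp: valid_def intro: le_trans[OF diff_le_self])
      moreover have mixed: "mixed sz m ?d + radix sz p = t"
        using mixed_upd[OF p, of sz d "d p - 1"] dp assms(2) by (cases "d p") auto
      \<comment> \<open>Place values are positive, so the entry needed is already in the
        table.\<close>
      moreover from mixed have "mixed sz m ?d < t" using radix_pos[of sz p] by linarith
      ultimately have "arr COUNT s' (mixed sz m ?d) = ext_count ?d"
        using s'(1) unfolding counted_def by blast
      moreover have "t - arr WEIGHT s' p = mixed sz m ?d"
        using s'(1) p mixed unfolding counted_def by auto
      moreover have "{j. j < Suc p \<and> removable q n d j} = insert p {j. j < p \<and> removable q n d j}"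
        using True by (auto simp: less_Suc_eq)
      ultimately show ?thesis using True s'(6) by (simp add: A_def)
    next
      case False
      then have "{j. j < Suc p \<and> removable q n d j} = {j. j < p \<and> removable q n d j}"
        by (auto simp: less_Suc_eq)
      then show ?thesis using False s'(6) by (simp add: A_def)
    qed
    show ?case
    proof (rule runs_straight, goal_cases)
      case 3
      show ?case using s'(1-5) A p by (simp split: if_splits)
    qed simp_all
  qed (use I in \<open>simp_all add: top_elem_def\<close>)
next
  case (3 s)
  then have "fst s ''p'' = m" by (auto simp: counted_def ready_def)
  with 3 show ?case using ext_count_rec[OF assms(1)] assms(2) by simp
next
  case 4
  show ?case by simp
next
  case 5
  show ?case by simp
qed

text \<open>
  While no digit has been increased, the value of the counter plus the place value of the current
  position is \<open>Suc t\<close>: resetting a full digit moves its contribution to the next place value.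
\<close>

lemma runs_carry_loop:
  assumes "valid (arr DIGIT s)" "mixed sz m (arr DIGIT s) = t" "t < radix sz m"
    and "counted (Suc t) s" "fst s ''t'' = t" "fst s ''p'' = 0" "fst s ''v'' = 0"
  shows "runs (While (Conj (Less (V ''p'') (V ''m'')) (Less (V ''v'') (N 1))) carry_body) s (m * (1000 + 100) + 100)
    (\<lambda>s. counted (Suc t) s \<and> fst s ''t'' = t \<and> valid (arr DIGIT s) \<and>
      (Suc t < radix sz m \<longrightarrow> mixed sz m (arr DIGIT s) = Suc t))"
\<comment> \<open>The measure drops to 0 as soon as a digit is raised, which leaves \<open>p\<close>
  unchanged but ends the loop.\<close>
proof (rule runs_While[where \<mu> = "\<lambda>s. if fst s ''v'' = 0 then m - fst s ''p'' else 0" and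
    I = "\<lambda>s. counted (Suc t) s \<and> fst s ''t'' = t \<and> valid (arr DIGIT s) \<and>
      (if fst s ''v'' = 0 then fst s ''p'' \<le> m \<and> mixed sz m (arr DIGIT s) + radix sz (fst s ''p'') = Suc t
       else mixed sz m (arr DIGIT s) = Suc t)"], goal_cases)
  case 1
  then show ?case using assms by simp
next
  case (2 s)
  define p where "p = fst s ''p''"
  define d where "d = arr DIGIT s"
  have [simp]: "fst s ''p'' = p" "arr DIGIT s = d" by (simp_all add: p_def d_def)
  have I: "counted (Suc t) s" "fst s ''t'' = t" "valid d" "mixed sz m d + radix sz p = Suc t"
    and v: "fst s ''v'' = 0"
    using 2 by (auto split: if_splits)
  have p: "p < m" "arr SIZE s p = sz p"
    using 2 I(1) by (auto simp: counted_def ready_def)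
  have dp: "d p \<le> sz p" using I(3) p by (simp add: valid_def)
  show ?case
  proof (rule runs_straight, goal_cases)
    case 3
    show ?case
    proof (cases "d p < sz p")
      case True
      have "result carry_body s = upd ''p'' p (put DIGIT p (Suc (d p)) (upd ''v'' (Suc (d p)) (upd ''v'' 0 s)))"
        using True p by (simp add: carry_body_def)
      moreover have "valid (d(p := Suc (d p)))" using I(3) True by (auto simp: valid_def)
      moreover have "mixed sz m (d(p := Suc (d p))) = Suc t"
        using mixed_upd[OF p(1), of sz d "Suc (d p)"] I(4) by simp
      ultimately show ?thesis using I(1,2) v p(1) by (simp add: arr_put)
    next
      case False
      then have "d p = sz p" using dp by simp
      have "result carry_body s = upd ''p'' (Suc p) (put DIGIT p 0 (upd ''v'' 0 (upd ''v'' 0 s)))"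
        using False p by (simp add: carry_body_def)
      moreover have "valid (d(p := 0))" using I(3) by (auto simp: valid_def)
      moreover have "mixed sz m (d(p := 0)) + radix sz (Suc p) = Suc t"
        using mixed_upd[OF p(1), of sz d 0] I(4) \<open>d p = sz p\<close> by (simp add: radix_Suc algebra_simps)
      ultimately show ?thesis using I(1,2) v p(1) by (simp add: arr_put)
    qed
  qed (simp_all add: carry_body_def)
next
  case (3 s)
  show ?case
  proof (cases "fst s ''v'' = 0")
    case True
    \<comment> \<open>Every digit wrapped, so \<open>Suc t\<close> is at least
      \<open>radix sz m\<close>: \<open>t\<close> was the last index and the claim about the next
      tuple is vacuous.\<close>
    then have "fst s ''p'' = m" using 3 by (auto simp: counted_def ready_def)
    then show ?thesis using 3 True by auto
  qed (use 3 in auto)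
next
  case 4
  show ?case by simp
next
  case 5
  show ?case by simp
qed

text \<open>By injectivity of the numbering, one write settles all tuples of index \<open>t\<close>:
  they agree with \<open>d\<close> on the first \<open>m\<close> digits, and
  \<open>ext_count\<close> sees no others.\<close>

lemma counted_put_count:
  assumes "counted t s" "valid d" "mixed sz m d = t"
  shows "counted (Suc t) (put COUNT t (ext_count d) s)"
proof -
  have "ext_count d' = ext_count d" if "valid d'" "mixed sz m d' = t" for d'
    using mixed_inj[of m d' sz d] that assms by (intro ext_count_cong) (auto simp: valid_def)
  then show ?thesis
    using assms(1) by (auto simp: counted_def arr_put less_Suc_eq)
qed

lemma runs_count_extensions:
  assumes "counted 0 s" "\<forall>p. arr DIGIT s p = 0"
  shows "runs count_extensions s (100 + (radix sz m *
      ((1000 + ((m * ((5000 + ((m * (5000 + 100) + 100) + 5000)) + 100) + 100) +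
         (1000 + ((m * (1000 + 100) + 100) + 100)))) + 100) + 100))
    (counted (radix sz m))"
  unfolding count_extensions_def
proof (rule runs_straight_Seq, goal_cases)
  case 3
  show ?case
  proof (rule runs_While[where \<mu> = "\<lambda>s. radix sz m - fst s ''t''" and
      I = "\<lambda>s. counted (fst s ''t'') s \<and> valid (arr DIGIT s) \<and> fst s ''t'' \<le> radix sz m \<and>
        (fst s ''t'' < radix sz m \<longrightarrow> mixed sz m (arr DIGIT s) = fst s ''t'')"], goal_cases)
    case 1
    show ?case using assms by (simp add: valid_def mixed_eq_0_iff)
  next
    case (2 s)
    define t where "t = fst s ''t''"
    define d where "d = arr DIGIT s"
    have t: "t < radix sz m" using 2 by (simp add: t_def counted_def)
    then have I: "counted t s" "valid d" "mixed sz m d = t" "fst s ''t'' = t" "arr DIGIT s = d"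
      using 2 by (auto simp: t_def d_def)
    show ?case unfolding count_body_def I(4)
    proof (rule runs_straight_Seq[OF _ _ runs_Seq[OF runs_add_loop[OF I(2,3)]
          runs_straight_Seq[OF _ _ runs_Seq[OF runs_carry_loop[of _ t]]]]], goal_cases)
      case (13 s')
      then show ?case using counted_put_count[of t s' d] I(2,3) by simp
    next
      case (17 s' s'')
      then show ?case using t by (intro runs_straight) auto
    qed (use I t in \<open>auto simp: arr_put\<close>)
  next
    case (3 s)
    then have "fst s ''t'' = radix sz m" by (auto simp: counted_def)
    with 3 show ?case by simp
  next
    case 4
    show ?case by simp
  next
    case 5
    show ?case by simp
  qed
qed simp_all

lemma runs_write_output:
  assumes "counted (radix sz m) s"
  shows "runs write_output s 1000 (\<lambda>s. snd s 0 = card (weak_interval n \<sigma>\<^sub>1 \<sigma>\<^sub>2))"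
proof (rule runs_straight, goal_cases)
  case 3
  have "mixed sz m sz = radix sz m - 1" using mixed_max[of sz m] by simp
  moreover have "mixed sz m sz < radix sz m" using mixed_max[of sz m] by simp
  ultimately have "arr COUNT s (radix sz m - 1) = card (lin_exts (common_order q) {1..n})"
    using assms unfolding counted_def valid_def ext_count_def by (metis order_refl prefixes_full)
  then show ?case
    using assms card_weak_interval[OF perm1 perm2] card_weak_interval_empty[of n \<sigma>\<^sub>1 \<sigma>\<^sub>2]
    by (auto simp: write_output_def counted_def ready_def q_def)
qed (simp_all add: write_output_def)

section \<open>Total running time\<close>

lemma levels_le_width_input: "m \<le> width n (inv \<sigma>\<^sub>1 \<circ> \<sigma>\<^sub>2)"
proof -
  have "inv q = inv \<sigma>\<^sub>1 \<circ> \<sigma>\<^sub>2"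
    unfolding q_def using permutes_bij[OF perm1] permutes_bij[OF perm2]
    by (simp add: o_inv_distrib bij_imp_bij_inv inv_inv_eq)
  then show ?thesis using levels_le_width[OF q_permutes] by simp
qed

lemma runs_interval_program:
  assumes "width n (inv \<sigma>\<^sub>1 \<circ> \<sigma>\<^sub>2) \<le> k"
  shows "runs interval_program (input_state n \<sigma>\<^sub>1 \<sigma>\<^sub>2) (100000 * (k ^ 2 * n ^ max 3 k))
    (\<lambda>s. snd s 0 = card (weak_interval n \<sigma>\<^sub>1 \<sigma>\<^sub>2))"
proof -
  define X where "X = k ^ 2 * n ^ max 3 k"
  \<comment> \<open>A nonempty input has a level, so \<open>1 \<le> k\<close> and the target bound
    is not 0; the constant terms need this.\<close>
  have "lev q 1 < m" using n_pos by (intro lev_less_levels) auto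
  then have m: "1 \<le> m" "m \<le> k" using levels_le_width_input assms by auto
  have X: "a * b \<le> X" if "a \<le> k ^ 2" "b \<le> n ^ j" "j \<le> max 3 k" for a b j
    unfolding X_def using that(1) order_trans[OF that(2) power_increasing[OF that(3) n_pos]] by (rule mult_mono) simp_all
  have k: "1 \<le> k ^ 2" "m \<le> k ^ 2" "m * m \<le> k ^ 2"
    using m mult_mono[OF m(2) m(2)] le_trans[OF m(2) self_le_power[of k 2]] by (auto simp: power2_eq_square)
  define R where "R = radix sz m"
  have "R \<le> 2 * n ^ m" unfolding R_def using radix_chain_le[OF n_pos] by simp
  then have R: "a * R \<le> 2 * X" if "a \<le> k ^ 2" for a
  proof -
    have "a * R \<le> a * (2 * n ^ m)" using \<open>R \<le> 2 * n ^ m\<close> by (rule mult_left_mono) simp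
    also have "\<dots> \<le> 2 * X" using X[OF that, of "n ^ m" m] m(2) by simp
    finally show ?thesis .
  qed
  \<comment> \<open>These are the monomials of the expanded running time. With the factor 2 of
    \<open>R\<close> counted, their coefficients add up to about 50000, within the constant
    100000.\<close>
  have bounds: "1 \<le> X" "n \<le> X" "n * n \<le> X" "m \<le> X" "m * n \<le> X" "R \<le> 2 * X" "m * R \<le> 2 * X" "m * m * R \<le> 2 * X"
    using X[OF k(1), of 1 0] X[OF k(1), of n 1] X[OF k(1), of "n * n" 2] X[OF k(2), of 1 0] X[OF k(2), of n 1]
      R[OF k(1)] R[OF k(2)] R[OF k(3)]
    by (simp_all add: power2_eq_square)
  have "runs interval_program (input_state n \<sigma>\<^sub>1 \<sigma>\<^sub>2) ((100 + (n * (2000 + 100) + 100)) +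
      ((100 + (n * ((2000 + ((n * (1000 + 100) + 100) + 4000)) + 100) + 100)) +
      ((100 + (m * ((1000 + ((n * (100 + 100) + 100) + 100)) + 100) + 100)) +
      ((100 + (R *
      ((1000 + ((m * ((5000 + ((m * (5000 + 100) + 100) + 5000)) + 100) + 100) +
         (1000 + ((m * (1000 + 100) + 100) + 100)))) + 100) + 100)) + 1000))))
    (\<lambda>s. snd s 0 = card (weak_interval n \<sigma>\<^sub>1 \<sigma>\<^sub>2))"
    unfolding interval_program_def R_def
  proof (rule runs_Seq[OF runs_read_input], rule runs_Seq[OF runs_build_chains],
      goal_cases _ _ chains)
    case (chains s s')
    then have "ready s'" "\<forall>p. arr DIGIT s' p = 0" using chains_upto_ready by auto
    then show ?case
      by (rule runs_Seq[OF runs_compute_weights], intro runs_Seq[OF runs_count_extensions runs_write_output])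
        (auto simp: counted_def)
  qed auto
  then show ?thesis
    unfolding X_def[symmetric]
    by (rule runs_weaken) (use bounds in \<open>simp_all add: algebra_simps\<close>)
qed

end

theorem theorem8:
  shows "\<exists>(c :: com) (C :: nat). \<forall>(n :: nat) (k :: nat) (\<sigma>\<^sub>1 :: nat \<Rightarrow> nat) (\<sigma>\<^sub>2 :: nat \<Rightarrow> nat).
           n \<ge> 1 \<longrightarrow> \<sigma>\<^sub>1 permutes {1..n} \<longrightarrow> \<sigma>\<^sub>2 permutes {1..n} \<longrightarrow>
           width n (inv \<sigma>\<^sub>1 \<circ> \<sigma>\<^sub>2) \<le> k \<longrightarrow>
           computes_within c (input_state n \<sigma>\<^sub>1 \<sigma>\<^sub>2) (card (weak_interval n \<sigma>\<^sub>1 \<sigma>\<^sub>2))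
             (C * (k ^ 2 * n ^ max 3 k))"
proof (intro exI allI impI)
  fix n k :: nat and \<sigma>\<^sub>1 \<sigma>\<^sub>2 :: "nat \<Rightarrow> nat"
  assume "n \<ge> 1" "\<sigma>\<^sub>1 permutes {1..n}" "\<sigma>\<^sub>2 permutes {1..n}" and w: "width n (inv \<sigma>\<^sub>1 \<circ> \<sigma>\<^sub>2) \<le> k"
  then interpret input_permutations n \<sigma>\<^sub>1 \<sigma>\<^sub>2 by unfold_locales
  show "computes_within interval_program (input_state n \<sigma>\<^sub>1 \<sigma>\<^sub>2) (card (weak_interval n \<sigma>\<^sub>1 \<sigma>\<^sub>2))
      (100000 * (k ^ 2 * n ^ max 3 k))"
    using runs_interval_program[OF w] unfolding runs_def computes_within_def by blast
qed

end
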